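(* Let $d\ge 1$, $S=\{x\in\mathbb{Z}^d: x_1\ge 0\}$, and for $n\ge 0$ let $p_n$ be the projection on $\mathcal{H}=l^2(\mathbb{Z}^d)$ given by $(p_n\phi)(x)=\phi(x)$ if $x_1\ge -n$ and $(p_n\phi)(x)=0$ otherwise. Let $A$ be an operator on $l^2(\mathbb{Z}^d)$ of the form $$(A\phi)(x)=\sum_{r=1}^m a_r(x)\,\phi(x+b_r),$$ where $m\in\mathbb{Z}_+$, $b_r\in\mathbb{Z}^d$ and $a_r\in l^\infty(\mathbb{Z}^d)$ for all $r\in\{1,\dots,m\}$, and suppose that $A$ is periodic in the $x_1$ direction. Let $H=A+B$, where $B$ is any bounded operator on $l^2(\mathbb{Z}^d)$ confined to $S$ in the sense that $p_0B=Bp_0=B$. Let $\mathcal{J}$ be the norm closure of $\{x\in\mathcal{L}(\mathcal{H}):\exists n\ge 1,\ p_nx=xp_n=x\}$. Then $$\sigma(A)=\sigma_{\rm ess}(A)=\sigma(\pi_{\mathcal{J}}(H))\subseteq\sigma_{\rm ess}(H)\subseteq\sigma(H).$$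
   Context: $\mathcal{L}(\mathcal{H})$ denotes the bounded operators on $\mathcal{H}$ and $\mathcal{K}(\mathcal{H})$ the compact operators. $\mathcal{J}$ is a closed two-sided ideal in the $C^*$-algebra $\mathcal{A}=\{a\in\mathcal{L}(\mathcal{H}): a\mathcal{J}\subseteq\mathcal{J}\text{ and }\mathcal{J}a\subseteq\mathcal{J}\}$; $\pi_{\mathcal{J}}:\mathcal{A}\to\mathcal{A}/\mathcal{J}$ is the quotient map, and $\sigma(\pi_{\mathcal{J}}(x))$ is the spectrum in $\mathcal{A}/\mathcal{J}$ (the operators $A,H$ lie in $\mathcal{A}$). $\sigma_{\rm ess}(x)$ is the spectrum of the image of $x$ in the Calkin algebra $\mathcal{L}(\mathcal{H})/\mathcal{K}(\mathcal{H})$. $A$ is periodic in the $x_1$ direction if there is an integer $k\ge 1$ such that $A$ commutes with the translation $(T_k\phi)(x)=\phi(x_1+k,x_2,\dots,x_d)$. *)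

theory Defs
  imports
    "HOL-Analysis.Analysis"
    "HOL-Algebra.Module"
    "HOL-Algebra.QuotRing"
begin

section \<open>The Hilbert space of square-summable complex functions\<close>

typedef 'a ell2 = "{f :: 'a \<Rightarrow> complex. (\<lambda>x. (cmod (f x))\<^sup>2) summable_on UNIV}"
  morphisms ell2_apply Abs_ell2
  by (rule exI[of _ "\<lambda>_. 0"]) simp

setup_lifting type_definition_ell2

lemma ell2_add_aux:
  fixes f g :: "'a \<Rightarrow> complex"
  assumes f: "(\<lambda>x. (cmod (f x))\<^sup>2) summable_on UNIV"
    and g: "(\<lambda>x. (cmod (g x))\<^sup>2) summable_on UNIV"
  shows "(\<lambda>x. (cmod (f x + g x))\<^sup>2) summable_on UNIV"
    and "sqrt (\<Sum>\<^sub>\<infinity>x. (cmod (f x + g x))\<^sup>2)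
           \<le> sqrt (\<Sum>\<^sub>\<infinity>x. (cmod (f x))\<^sup>2) + sqrt (\<Sum>\<^sub>\<infinity>x. (cmod (g x))\<^sup>2)"
      (is "_ \<le> ?N")
proof -
  have N: "0 \<le> ?N"
    by (simp add: infsum_nonneg)
  have bound: "(\<Sum>x\<in>F. (cmod (f x + g x))\<^sup>2) \<le> ?N\<^sup>2" if "finite F" for F
  proof -
    have "L2_set (\<lambda>x. cmod (f x + g x)) F \<le> L2_set (\<lambda>x. cmod (f x) + cmod (g x)) F"
      by (rule L2_set_mono) (auto simp: norm_triangle_ineq)
    also have "\<dots> \<le> L2_set (\<lambda>x. cmod (f x)) F + L2_set (\<lambda>x. cmod (g x)) F"
      by (rule L2_set_triangle_ineq)
    also have "\<dots> \<le> ?N"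
      unfolding L2_set_def
      using that f g by (intro add_mono real_sqrt_le_mono finite_sum_le_infsum) auto
    finally have "(L2_set (\<lambda>x. cmod (f x + g x)) F)\<^sup>2 \<le> ?N\<^sup>2"
      by (rule power_mono) (rule L2_set_nonneg)
    then show ?thesis
      by (simp add: L2_set_def sum_nonneg)
  qed
  show *: "(\<lambda>x. (cmod (f x + g x))\<^sup>2) summable_on UNIV"
    by (rule nonneg_bdd_above_summable_on)
       (auto intro!: bdd_aboveI[where M="?N\<^sup>2"] bound)
  have "(\<Sum>\<^sub>\<infinity>x. (cmod (f x + g x))\<^sup>2) \<le> ?N\<^sup>2"
    by (rule infsum_le_finite_sums[OF *]) (use bound in auto)
  then show "sqrt (\<Sum>\<^sub>\<infinity>x. (cmod (f x + g x))\<^sup>2) \<le> ?N"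
    using N by (simp add: real_le_lsqrt)
qed

lemma ell2_scale_aux:
  fixes f :: "'a \<Rightarrow> complex"
  assumes "(\<lambda>x. (cmod (f x))\<^sup>2) summable_on UNIV"
  shows "(\<lambda>x. (cmod (c * f x))\<^sup>2) summable_on UNIV"
  using summable_on_cmult_right[OF assms, of "(cmod c)\<^sup>2"]
  by (simp add: norm_mult power_mult_distrib)

instantiation ell2 :: (type) real_normed_vector
begin

lift_definition zero_ell2 :: "'a ell2" is "\<lambda>_. 0"
  by simp

lift_definition plus_ell2 :: "'a ell2 \<Rightarrow> 'a ell2 \<Rightarrow> 'a ell2" is "\<lambda>f g x. f x + g x"
  by (rule ell2_add_aux(1))

lift_definition uminus_ell2 :: "'a ell2 \<Rightarrow> 'a ell2" is "\<lambda>f x. - f x"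
  by simp

lift_definition minus_ell2 :: "'a ell2 \<Rightarrow> 'a ell2 \<Rightarrow> 'a ell2" is "\<lambda>f g x. f x - g x"
  subgoal for f g using ell2_add_aux(1)[of f "\<lambda>x. - g x"] by simp
  done

lift_definition scaleR_ell2 :: "real \<Rightarrow> 'a ell2 \<Rightarrow> 'a ell2" is "\<lambda>r f x. complex_of_real r * f x"
  by (rule ell2_scale_aux)

lift_definition norm_ell2 :: "'a ell2 \<Rightarrow> real" is "\<lambda>f. sqrt (\<Sum>\<^sub>\<infinity>x. (cmod (f x))\<^sup>2)" .

definition sgn_ell2 :: "'a ell2 \<Rightarrow> 'a ell2" where "sgn_ell2 \<phi> = scaleR (inverse (norm \<phi>)) \<phi>"

definition dist_ell2 :: "'a ell2 \<Rightarrow> 'a ell2 \<Rightarrow> real" where "dist_ell2 \<phi> \<psi> = norm (\<phi> - \<psi>)"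

definition uniformity_ell2 :: "('a ell2 \<times> 'a ell2) filter"
  where "uniformity_ell2 = (INF e\<in>{0 <..}. principal {(\<phi>, \<psi>). dist \<phi> \<psi> < e})"

definition open_ell2 :: "'a ell2 set \<Rightarrow> bool"
  where "open_ell2 U = (\<forall>\<phi>\<in>U. eventually (\<lambda>(\<phi>', \<psi>). \<phi>' = \<phi> \<longrightarrow> \<psi> \<in> U) uniformity)"

instance
proof
  fix \<phi> \<psi> \<theta> :: "'a ell2" and r s :: real and U :: "'a ell2 set"
  show "\<phi> + \<psi> + \<theta> = \<phi> + (\<psi> + \<theta>)" by transfer (simp add: add.assoc)
  show "\<phi> + \<psi> = \<psi> + \<phi>" by transfer (simp add: add.commute)
  show "0 + \<phi> = \<phi>" by transfer simp
  show "- \<phi> + \<phi> = 0" by transfer simp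
  show "\<phi> - \<psi> = \<phi> + - \<psi>" by transfer simp
  show "r *\<^sub>R (\<phi> + \<psi>) = r *\<^sub>R \<phi> + r *\<^sub>R \<psi>" by transfer (simp add: algebra_simps)
  show "(r + s) *\<^sub>R \<phi> = r *\<^sub>R \<phi> + s *\<^sub>R \<phi>" by transfer (simp add: algebra_simps)
  show "r *\<^sub>R s *\<^sub>R \<phi> = (r * s) *\<^sub>R \<phi>" by transfer (simp add: algebra_simps)
  show "1 *\<^sub>R \<phi> = \<phi>" by transfer simp
  show "dist \<phi> \<psi> = norm (\<phi> - \<psi>)" by (rule dist_ell2_def)
  show "sgn \<phi> = scaleR (inverse (norm \<phi>)) \<phi>" by (rule sgn_ell2_def)
  show "uniformity = (INF e\<in>{0 <..}. principal {(\<phi>, \<psi> :: 'a ell2). dist \<phi> \<psi> < e})"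
    by (rule uniformity_ell2_def)
  show "open U = (\<forall>\<phi>\<in>U. \<forall>\<^sub>F (\<phi>', \<psi>) in uniformity. \<phi>' = \<phi> \<longrightarrow> \<psi> \<in> U)"
    by (rule open_ell2_def)
  show "(norm \<phi> = 0) = (\<phi> = 0)"
  proof transfer
    fix f :: "'a \<Rightarrow> complex"
    assume f: "(\<lambda>x. (cmod (f x))\<^sup>2) summable_on UNIV"
    show "(sqrt (\<Sum>\<^sub>\<infinity>x. (cmod (f x))\<^sup>2) = 0) = (f = (\<lambda>_. 0))"
    proof
      assume "sqrt (\<Sum>\<^sub>\<infinity>x. (cmod (f x))\<^sup>2) = 0"
      then have "(cmod (f x))\<^sup>2 = 0" for x
        by (intro nonneg_infsum_le_0D[OF _ f]) auto
      then show "f = (\<lambda>_. 0)" by auto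
    qed simp
  qed
  show "norm (\<phi> + \<psi>) \<le> norm \<phi> + norm \<psi>" by transfer (rule ell2_add_aux(2))
  show "norm (r *\<^sub>R \<phi>) = \<bar>r\<bar> * norm \<phi>"
    by transfer (simp add: norm_mult power_mult_distrib infsum_cmult_right' real_sqrt_mult)
qed

end

lift_definition ell2_scale :: "complex \<Rightarrow> 'a ell2 \<Rightarrow> 'a ell2" is "\<lambda>c f x. c * f x"
  by (rule ell2_scale_aux)

lemma norm_ell2_scale: "norm (ell2_scale c \<phi>) = cmod c * norm \<phi>"
  by transfer (simp add: norm_mult power_mult_distrib infsum_cmult_right' real_sqrt_mult)

lemma bounded_linear_ell2_scale: "bounded_linear (ell2_scale c)"
proof (rule bounded_linear_intro[where K = "cmod c"])
  fix \<phi> \<psi> :: "'a ell2" and r :: real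
  show "ell2_scale c (\<phi> + \<psi>) = ell2_scale c \<phi> + ell2_scale c \<psi>"
    by transfer (simp add: algebra_simps)
  show "ell2_scale c (r *\<^sub>R \<phi>) = r *\<^sub>R ell2_scale c \<phi>"
    by transfer (simp add: algebra_simps)
  show "norm (ell2_scale c \<phi>) \<le> norm \<phi> * cmod c"
    by (simp add: norm_ell2_scale mult.commute)
qed


section \<open>Operator algebras, ideals and spectra\<close>

type_synonym 'a op = "'a ell2 \<Rightarrow>\<^sub>L 'a ell2"

text \<open>Elements of type \<^typ>\<open>'a op\<close> are only real-linear, so the complex-linear ones are
  singled out as a subset.  Their operator norm is the norm of \<^typ>\<open>'a op\<close>.\<close>

definition bounded_ops :: "'a op set" where
  "bounded_ops = {T :: 'a op. \<forall>c \<phi>. T (ell2_scale c \<phi>) = ell2_scale c (T \<phi>)}"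

definition compact_ops :: "'a op set" where
  "compact_ops = {T \<in> bounded_ops. compact (closure (T ` cball 0 1))}"

definition op_scale :: "complex \<Rightarrow> 'a op \<Rightarrow> 'a op" where
  "op_scale c T = Blinfun (ell2_scale c) o\<^sub>L T"

lemma op_scale_apply: "op_scale c T \<phi> = ell2_scale c (T \<phi>)"
  by (simp add: op_scale_def bounded_linear_Blinfun_apply[OF bounded_linear_ell2_scale])

definition op_algebra :: "'a op set \<Rightarrow> (complex, 'a op) module" where
  "op_algebra \<A> = \<lparr>carrier = \<A>, mult = (o\<^sub>L), one = id_blinfun, zero = 0, add = (+),
     smult = op_scale\<rparr>"

text \<open>The quotient ring, together with the induced scalar multiplication
  \<open>z (I + x) = I + z x\<close>.\<close>

definition quotient_algebra ::
    "('c, 'b, 'm) module_scheme \<Rightarrow> 'b set \<Rightarrow> ('c, 'b set) module" where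
  "quotient_algebra M I =
     ring.extend (M Quot I) (module.fields (\<lambda>z X. \<Union>x\<in>X. I +>\<^bsub>M\<^esub> (z \<odot>\<^bsub>M\<^esub> x)))"

definition spectrum :: "(complex, 'b, 'm) module_scheme \<Rightarrow> 'b \<Rightarrow> complex set" where
  "spectrum M x = {z. x \<ominus>\<^bsub>M\<^esub> (z \<odot>\<^bsub>M\<^esub> \<one>\<^bsub>M\<^esub>) \<notin> Units M}"

definition quotient_spectrum ::
    "(complex, 'b, 'm) module_scheme \<Rightarrow> 'b set \<Rightarrow> 'b \<Rightarrow> complex set" where
  "quotient_spectrum M I x = spectrum (quotient_algebra M I) (I +>\<^bsub>M\<^esub> x)"

definition op_spectrum :: "'a op \<Rightarrow> complex set" where
  "op_spectrum T = spectrum (op_algebra bounded_ops) T"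

definition ess_spectrum :: "'a op \<Rightarrow> complex set" where
  "ess_spectrum T = quotient_spectrum (op_algebra bounded_ops) compact_ops T"

definition idealizer :: "'a op set \<Rightarrow> 'a op set" where
  "idealizer J = {T \<in> bounded_ops. (\<forall>X\<in>J. T o\<^sub>L X \<in> J) \<and> (\<forall>X\<in>J. X o\<^sub>L T \<in> J)}"


section \<open>Lattice operators\<close>

text \<open>The lattice is \<^typ>\<open>int ^ 'd\<close>; an index \<open>e :: 'd\<close> selects the
  coordinate that plays the role of \<open>x\<^sub>1\<close>.\<close>

type_synonym 'd lattice = "int ^ 'd"

lift_definition ell2_truncate :: "'d::finite \<Rightarrow> nat \<Rightarrow> 'd lattice ell2 \<Rightarrow> 'd lattice ell2"
  is "\<lambda>e n f x. if - int n \<le> x $ e then f x else 0"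
  subgoal for e n f
    by (rule summable_on_comparison_test[where f = "\<lambda>x. (cmod (f x))\<^sup>2"]) auto
  done

lift_definition ell2_shift :: "'d::finite lattice \<Rightarrow> 'd lattice ell2 \<Rightarrow> 'd lattice ell2"
  is "\<lambda>v f x. f (x + v)"
  subgoal for v f
    using summable_on_reindex_bij_betw[OF bij_plus_right[of v], of "\<lambda>x. (cmod (f x))\<^sup>2"] by simp
  done

lemma norm_ell2_truncate: "norm (ell2_truncate e n \<phi>) \<le> norm \<phi>"
proof transfer
  fix e :: "'d::finite" and n and f :: "'d lattice \<Rightarrow> complex"
  assume f: "(\<lambda>x. (cmod (f x))\<^sup>2) summable_on UNIV"
  have "(\<lambda>x. (cmod (if - int n \<le> x $ e then f x else 0))\<^sup>2) summable_on UNIV"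
    by (rule summable_on_comparison_test[OF f]) auto
  then have "(\<Sum>\<^sub>\<infinity>x. (cmod (if - int n \<le> x $ e then f x else 0))\<^sup>2) \<le> (\<Sum>\<^sub>\<infinity>x. (cmod (f x))\<^sup>2)"
    using f by (rule infsum_mono) auto
  then show "sqrt (\<Sum>\<^sub>\<infinity>x. (cmod (if - int n \<le> x $ e then f x else 0))\<^sup>2)
      \<le> sqrt (\<Sum>\<^sub>\<infinity>x. (cmod (f x))\<^sup>2)"
    by simp
qed

lemma norm_ell2_shift: "norm (ell2_shift v \<phi>) = norm \<phi>"
proof transfer
  fix v :: "'d::finite lattice" and f :: "'d lattice \<Rightarrow> complex"
  show "sqrt (\<Sum>\<^sub>\<infinity>x. (cmod (f (x + v)))\<^sup>2) = sqrt (\<Sum>\<^sub>\<infinity>x. (cmod (f x))\<^sup>2)"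
    using infsum_reindex_bij_betw[OF bij_plus_right[of v], of "\<lambda>x. (cmod (f x))\<^sup>2"] by simp
qed

lemma bounded_linear_ell2_truncate: "bounded_linear (ell2_truncate (e :: 'd::finite) n)"
proof (rule bounded_linear_intro[where K = 1])
  fix \<phi> \<psi> :: "'d lattice ell2" and r :: real
  show "ell2_truncate e n (\<phi> + \<psi>) = ell2_truncate e n \<phi> + ell2_truncate e n \<psi>"
    by transfer auto
  show "ell2_truncate e n (r *\<^sub>R \<phi>) = r *\<^sub>R ell2_truncate e n \<phi>"
    by transfer auto
  show "norm (ell2_truncate e n \<phi>) \<le> norm \<phi> * 1"
    by (simp add: norm_ell2_truncate)
qed

lemma bounded_linear_ell2_shift: "bounded_linear (ell2_shift (v :: 'd::finite lattice))"
proof (rule bounded_linear_intro[where K = 1])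
  fix \<phi> \<psi> :: "'d lattice ell2" and r :: real
  show "ell2_shift v (\<phi> + \<psi>) = ell2_shift v \<phi> + ell2_shift v \<psi>"
    by transfer auto
  show "ell2_shift v (r *\<^sub>R \<phi>) = r *\<^sub>R ell2_shift v \<phi>"
    by transfer auto
  show "norm (ell2_shift v \<phi>) \<le> norm \<phi> * 1"
    by (simp add: norm_ell2_shift)
qed

definition half_space_proj :: "'d::finite \<Rightarrow> nat \<Rightarrow> 'd lattice op" where
  "half_space_proj e n = Blinfun (ell2_truncate e n)"

definition translation :: "'d::finite \<Rightarrow> int \<Rightarrow> 'd lattice op" where
  "translation e k = Blinfun (ell2_shift (axis e k))"

lemma half_space_proj_apply:
  "ell2_apply (half_space_proj e n \<phi>) x = (if - int n \<le> x $ e then ell2_apply \<phi> x else 0)"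
  by (simp add: half_space_proj_def bounded_linear_Blinfun_apply[OF bounded_linear_ell2_truncate]
      ell2_truncate.rep_eq)

lemma translation_apply: "ell2_apply (translation e k \<phi>) x = ell2_apply \<phi> (x + axis e k)"
  by (simp add: translation_def bounded_linear_Blinfun_apply[OF bounded_linear_ell2_shift]
      ell2_shift.rep_eq)

definition half_space_ideal :: "'d::finite \<Rightarrow> 'd lattice op set" where
  "half_space_ideal e = closure {X \<in> bounded_ops.
     \<exists>n\<ge>1. half_space_proj e n o\<^sub>L X = X \<and> X o\<^sub>L half_space_proj e n = X}"

definition periodic :: "'d::finite \<Rightarrow> 'd lattice op \<Rightarrow> bool" where
  "periodic e A \<longleftrightarrow> (\<exists>k\<ge>1. A o\<^sub>L translation e k = translation e k o\<^sub>L A)"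

end

theory Submission
  imports Defs
begin

text \<open>
  All four spectra are compared with that of \<open>A\<close>.  Write \<open>D = A - z\<close>, so that
  \<open>H - z = D + B\<close>, let \<open>\<J>\<close> be the closed ideal of the half-space \<open>S\<close>, and let
  \<open>T\<close> be a translation by a multiple of the period in the direction that makes
  \<open>T\<^sup>n \<phi>\<close> run away from \<open>S\<close>.

  The resolvent stays in the idealizer.  A ramp \<open>f\<close> that falls linearly from \<open>1\<close> to \<open>0\<close> over
  a strip of width \<open>N\<close> has a commutator of norm \<open>O(1 / N)\<close> with every operator of finite range,
  hence also with an inverse \<open>G\<close> of \<open>D\<close>, because \<open>f G - G f = G (D f - f D) G\<close>.  Such operators
  idealize \<open>\<J>\<close> (\<open>almost_commutes_idealizer\<close>, \<open>inverse_almost_commutes\<close>).  As \<open>B\<close> is in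
  \<open>\<J>\<close>, the operator \<open>G\<close> inverts \<open>H - z\<close> modulo \<open>\<J>\<close>, and the spectrum of
  \<open>H\<close> modulo \<open>\<J>\<close> lies in that of \<open>A\<close>.

  Far away from \<open>S\<close> only \<open>A\<close> is visible.  Let \<open>G\<close> be an inverse of \<open>D + B\<close> modulo \<open>\<J>\<close>
  or modulo the compact operators.  The defects of \<open>G\<close>, the perturbation \<open>B\<close> and the product
  \<open>B G\<close> all tend to \<open>0\<close> strongly along \<open>T\<^sup>n\<close>.  For \<open>\<J>\<close> this holds because
  \<open>T\<^sup>n \<phi>\<close> leaves every half-space \<open>x\<^sub>1 \<ge> -m\<close>; compact operators annihilate
  sequences like \<open>T\<^sup>n \<phi>\<close> in the limit (\<open>compact_ops_vanishing\<close>); and for \<open>B G\<close> modulo compact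
  operators the ramps are used once more (\<open>compose_quasi_inverse_vanishing\<close>).  Since \<open>T\<close> is an
  isometry commuting with \<open>D\<close>, the limit gives a lower bound and a dense range for \<open>D\<close>, so
  \<open>D\<close> is invertible (\<open>invertible_if_quasi_invertible_far_away\<close>).  Therefore the spectrum of
  \<open>A\<close> lies in that of \<open>H\<close> modulo \<open>\<J>\<close> and in the essential spectrum of \<open>A + B\<close> for every
  \<open>B\<close> confined to \<open>S\<close>; the case \<open>B = 0\<close> concerns the essential spectrum of \<open>A\<close> itself.

  The remaining inclusions hold because an inverse is an inverse modulo every ideal.
\<close>

section \<open>Analysis in the space of square-summable functions\<close>

lemma ell2_eqI: "(\<And>x. ell2_apply \<phi> x = ell2_apply \<psi> x) \<Longrightarrow> \<phi> = \<psi>"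
  by (simp add: ell2_apply_inject[symmetric] ext)

lemma op_eqI: "(\<And>\<phi> x. ell2_apply (blinfun_apply X \<phi>) x = ell2_apply (blinfun_apply Y \<phi>) x) \<Longrightarrow> X = Y"
  by (intro blinfun_eqI ell2_eqI)

lemmas ell2_apply_simps = zero_ell2.rep_eq plus_ell2.rep_eq minus_ell2.rep_eq
  scaleR_ell2.rep_eq ell2_scale.rep_eq

lemma ell2_apply_sum: "ell2_apply (\<Sum>i\<in>I. f i) x = (\<Sum>i\<in>I. ell2_apply (f i) x)"
  by (induction I rule: infinite_finite_induct) (auto simp: ell2_apply_simps)

lemma ell2_scale_add: "ell2_scale c (\<phi> + \<psi>) = ell2_scale c \<phi> + ell2_scale c \<psi>"
  and ell2_scale_diff: "ell2_scale c (\<phi> - \<psi>) = ell2_scale c \<phi> - ell2_scale c \<psi>"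
  by (auto intro!: ell2_eqI simp: ell2_apply_simps algebra_simps)

lemma sum_le_norm_ell2:
  assumes "finite F"
  shows "(\<Sum>x\<in>F. (cmod (ell2_apply \<phi> x))\<^sup>2) \<le> (norm \<phi>)\<^sup>2"
proof -
  have s: "(\<lambda>x. (cmod (ell2_apply \<phi> x))\<^sup>2) summable_on UNIV"
    using ell2_apply[of \<phi>] by simp
  have "(norm \<phi>)\<^sup>2 = (\<Sum>\<^sub>\<infinity>x. (cmod (ell2_apply \<phi> x))\<^sup>2)"
    by (simp add: norm_ell2.rep_eq infsum_nonneg)
  then show ?thesis
    using finite_sum_le_infsum[OF s assms] by simp
qed

text \<open>A function is square-summable, with the obvious norm bound, as soon as its sums over finite
  sets are bounded; the norm bounds below are reduced to finite sums in this way.\<close>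

lemma ell2_of_finite_sums:
  fixes f :: "'a \<Rightarrow> complex"
  assumes C: "0 \<le> C" and f: "\<And>F. finite F \<Longrightarrow> (\<Sum>x\<in>F. (cmod (f x))\<^sup>2) \<le> C\<^sup>2"
  obtains \<phi> where "ell2_apply \<phi> = f" "norm \<phi> \<le> C"
proof -
  have s: "(\<lambda>x. (cmod (f x))\<^sup>2) summable_on UNIV"
    by (rule nonneg_bdd_above_summable_on) (auto intro!: bdd_aboveI[where M="C\<^sup>2"] f)
  have a: "ell2_apply (Abs_ell2 f) = f"
    using s by (simp add: Abs_ell2_inverse)
  have "(\<Sum>\<^sub>\<infinity>x. (cmod (f x))\<^sup>2) \<le> C\<^sup>2"
    by (rule infsum_le_finite_sums[OF s]) (use f in auto)
  then have "norm (Abs_ell2 f) \<le> C"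
    using C by (simp add: norm_ell2.rep_eq a real_le_lsqrt)
  with a show ?thesis using that by blast
qed

lemma norm_ell2_le_finite_sums:
  assumes "0 \<le> C" "\<And>F. finite F \<Longrightarrow> (\<Sum>x\<in>F. (cmod (ell2_apply \<phi> x))\<^sup>2) \<le> C\<^sup>2"
  shows "norm \<phi> \<le> C"
proof (rule ell2_of_finite_sums[OF assms])
  fix \<psi> assume "ell2_apply \<psi> = ell2_apply \<phi>" "norm \<psi> \<le> C"
  then show "norm \<phi> \<le> C" by (simp add: ell2_apply_inject)
qed

lemma norm_ell2_ge_point: "cmod (ell2_apply \<phi> x) \<le> norm \<phi>"
proof -
  have "(cmod (ell2_apply \<phi> x))\<^sup>2 \<le> (norm \<phi>)\<^sup>2"
    using sum_le_norm_ell2[of "{x}" \<phi>] by simp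
  then show ?thesis
    by (simp add: power2_le_iff_abs_le)
qed

lemma ell2_of_dominated:
  fixes f :: "'a \<Rightarrow> complex" and \<phi> :: "'b ell2"
  assumes g: "inj g" and C: "0 \<le> C"
    and f: "\<And>x. cmod (f x) \<le> C * cmod (ell2_apply \<phi> (g x))"
  obtains \<psi> where "ell2_apply \<psi> = f" "norm \<psi> \<le> C * norm \<phi>"
proof (rule ell2_of_finite_sums)
  fix F :: "'a set" assume F: "finite F"
  have "(\<Sum>x\<in>F. (cmod (f x))\<^sup>2) \<le> (\<Sum>x\<in>F. (C * cmod (ell2_apply \<phi> (g x)))\<^sup>2)"
    by (intro sum_mono power_mono f) auto
  also have "\<dots> = C\<^sup>2 * (\<Sum>y\<in>g ` F. (cmod (ell2_apply \<phi> y))\<^sup>2)"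
    using g by (simp add: sum.reindex inj_on_subset[OF g] power_mult_distrib sum_distrib_left)
  also have "\<dots> \<le> C\<^sup>2 * (norm \<phi>)\<^sup>2"
    using F by (intro mult_left_mono sum_le_norm_ell2) auto
  finally show "(\<Sum>x\<in>F. (cmod (f x))\<^sup>2) \<le> (C * norm \<phi>)\<^sup>2"
    by (simp add: power_mult_distrib)
qed (use C in auto)

text \<open>Completeness: the pointwise limit of a Cauchy sequence is square-summable because each of its
  finite sums is a limit of bounded finite sums.\<close>

lemma ell2_complete:
  fixes X :: "nat \<Rightarrow> 'a ell2"
  assumes X: "Cauchy X"
  shows "convergent X"
proof -
  have "Cauchy (\<lambda>n. ell2_apply (X n) x)" for x
  proof (rule CauchyI)
    fix \<epsilon> :: real assume "\<epsilon> > 0"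
    then obtain M where "\<forall>m\<ge>M. \<forall>n\<ge>M. norm (X m - X n) < \<epsilon>"
      using CauchyD[OF X] by blast
    then show "\<exists>M. \<forall>m\<ge>M. \<forall>n\<ge>M. norm (ell2_apply (X m) x - ell2_apply (X n) x) < \<epsilon>"
      using norm_ell2_ge_point[of "X _ - X _" x]
      by (metis (no_types, opaque_lifting) minus_ell2.rep_eq order_le_less_trans)
  qed
  then have "\<exists>l. \<forall>x. (\<lambda>n. ell2_apply (X n) x) \<longlonglongrightarrow> l x"
    by (intro choice) (meson Cauchy_convergent_iff convergent_def)
  then obtain l where l: "\<And>x. (\<lambda>n. ell2_apply (X n) x) \<longlonglongrightarrow> l x"
    by blast
  have tail: "\<exists>M. \<forall>n\<ge>M. \<exists>\<delta>. ell2_apply \<delta> = (\<lambda>x. l x - ell2_apply (X n) x) \<and> norm \<delta> \<le> \<epsilon>"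
    if \<epsilon>: "\<epsilon> > 0" for \<epsilon>
  proof -
    obtain M where M: "\<forall>m\<ge>M. \<forall>n\<ge>M. norm (X m - X n) < \<epsilon>"
      using CauchyD[OF X \<epsilon>] by blast
    show ?thesis
    proof (intro exI[of _ M] allI impI)
      fix n assume n: "n \<ge> M"
      have "(\<Sum>x\<in>F. (cmod (l x - ell2_apply (X n) x))\<^sup>2) \<le> \<epsilon>\<^sup>2" if F: "finite F" for F
      proof (rule tendsto_upperbound)
        show "(\<lambda>m. \<Sum>x\<in>F. (cmod (ell2_apply (X m) x - ell2_apply (X n) x))\<^sup>2)
            \<longlonglongrightarrow> (\<Sum>x\<in>F. (cmod (l x - ell2_apply (X n) x))\<^sup>2)"
          by (intro tendsto_intros l)
        show "\<forall>\<^sub>F m in sequentially.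
            (\<Sum>x\<in>F. (cmod (ell2_apply (X m) x - ell2_apply (X n) x))\<^sup>2) \<le> \<epsilon>\<^sup>2"
        proof (rule eventually_sequentiallyI)
          fix m assume "m \<ge> M"
          then have "(norm (X m - X n))\<^sup>2 \<le> \<epsilon>\<^sup>2"
            using M n by (intro power_mono) (auto intro: less_imp_le)
          with sum_le_norm_ell2[OF F, of "X m - X n"]
          show "(\<Sum>x\<in>F. (cmod (ell2_apply (X m) x - ell2_apply (X n) x))\<^sup>2) \<le> \<epsilon>\<^sup>2"
            by (simp add: ell2_apply_simps)
        qed
      qed simp
      then show "\<exists>\<delta>. ell2_apply \<delta> = (\<lambda>x. l x - ell2_apply (X n) x) \<and> norm \<delta> \<le> \<epsilon>"
        using ell2_of_finite_sums[of \<epsilon> "\<lambda>x. l x - ell2_apply (X n) x"] \<epsilon>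
        by (metis less_imp_le)
    qed
  qed
  obtain n \<delta> where \<delta>: "ell2_apply \<delta> = (\<lambda>x. l x - ell2_apply (X n) x)"
    using tail[of 1] by auto
  define L where "L = X n + \<delta>"
  have L: "ell2_apply L = l"
    by (auto simp: L_def \<delta> ell2_apply_simps)
  have "X \<longlonglongrightarrow> L"
  proof (rule LIMSEQ_I)
    fix \<epsilon> :: real assume "\<epsilon> > 0"
    then obtain M where M: "\<forall>n\<ge>M. \<exists>\<delta>. ell2_apply \<delta> = (\<lambda>x. l x - ell2_apply (X n) x) \<and> norm \<delta> \<le> \<epsilon>/2"
      using tail[of "\<epsilon>/2"] by auto
    have "norm (X n - L) < \<epsilon>" if n: "n \<ge> M" for n
    proof -
      obtain \<delta> where \<delta>: "ell2_apply \<delta> = (\<lambda>x. l x - ell2_apply (X n) x)" "norm \<delta> \<le> \<epsilon>/2"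
        using M n by blast
      then have "\<delta> = L - X n"
        by (intro ell2_eqI) (simp add: L ell2_apply_simps)
      with \<delta> \<open>\<epsilon> > 0\<close> show ?thesis
        by (simp add: norm_minus_commute)
    qed
    then show "\<exists>M. \<forall>n\<ge>M. norm (X n - L) < \<epsilon>" by blast
  qed
  then show ?thesis by (auto simp: convergent_def)
qed

lift_definition ell2_site :: "'a \<Rightarrow> complex \<Rightarrow> 'a ell2" is "\<lambda>y c x. if x = y then c else 0"
  subgoal for y c
    using summable_on_finite[of "{y}" "\<lambda>x. (cmod (if x = y then c else 0))\<^sup>2"]
    by (rule iffD1[OF summable_on_cong_neutral, rotated -1]) auto
  done

lemma ell2_apply_sum_sites:
  assumes "finite F"
  shows "ell2_apply (\<Sum>y\<in>F. ell2_site y (c y)) x = (if x \<in> F then c x else 0)"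
  using assms by (simp add: ell2_apply_sum ell2_site.rep_eq)

lemma norm_sum_sites_le:
  assumes "finite F"
  shows "norm (\<Sum>y\<in>F. ell2_site y (c y)) \<le> sqrt (\<Sum>y\<in>F. (cmod (c y))\<^sup>2)"
proof (rule norm_ell2_le_finite_sums)
  fix G :: "'a set" assume G: "finite G"
  have "(\<Sum>x\<in>G. (cmod (ell2_apply (\<Sum>y\<in>F. ell2_site y (c y)) x))\<^sup>2)
      = (\<Sum>x\<in>G. if x \<in> F then (cmod (c x))\<^sup>2 else 0)"
    using assms by (intro sum.cong) (auto simp: ell2_apply_sum_sites)
  also have "\<dots> = (\<Sum>x\<in>G \<inter> F. (cmod (c x))\<^sup>2)"
    using G by (simp add: sum.inter_restrict)
  also have "\<dots> \<le> (\<Sum>y\<in>F. (cmod (c y))\<^sup>2)"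
    using assms by (intro sum_mono2) auto
  finally show "(\<Sum>x\<in>G. (cmod (ell2_apply (\<Sum>y\<in>F. ell2_site y (c y)) x))\<^sup>2)
      \<le> (sqrt (\<Sum>y\<in>F. (cmod (c y))\<^sup>2))\<^sup>2"
    by (simp add: sum_nonneg)
qed (simp add: sum_nonneg)

text \<open>The finite sums of squares of \<open>\<phi>\<close> come arbitrarily close to the square of its norm, since
  otherwise they would bound the norm by something smaller; what is missing from such a sum is the
  squared distance from \<open>\<phi>\<close> to its restriction.\<close>

lemma sum_sites_dense:
  fixes \<phi> :: "'a ell2"
  assumes \<epsilon>: "\<epsilon> > 0"
  obtains F where "finite F" "norm (\<phi> - (\<Sum>y\<in>F. ell2_site y (ell2_apply \<phi> y))) \<le> \<epsilon>"
proof -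
  let ?q = "\<lambda>x. (cmod (ell2_apply \<phi> x))\<^sup>2"
  have "\<exists>F. finite F \<and> (norm \<phi>)\<^sup>2 - \<epsilon>\<^sup>2 < (\<Sum>x\<in>F. ?q x)"
  proof (rule ccontr)
    assume "\<nexists>F. finite F \<and> (norm \<phi>)\<^sup>2 - \<epsilon>\<^sup>2 < (\<Sum>x\<in>F. ?q x)"
    then have le: "finite F \<Longrightarrow> (\<Sum>x\<in>F. ?q x) \<le> (norm \<phi>)\<^sup>2 - \<epsilon>\<^sup>2" for F
      by (meson not_le)
    then have nn: "0 \<le> (norm \<phi>)\<^sup>2 - \<epsilon>\<^sup>2"
      using le[of "{}"] by simp
    then have "norm \<phi> \<le> sqrt ((norm \<phi>)\<^sup>2 - \<epsilon>\<^sup>2)"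
      by (intro norm_ell2_le_finite_sums) (use le in auto)
    then have "(norm \<phi>)\<^sup>2 \<le> (sqrt ((norm \<phi>)\<^sup>2 - \<epsilon>\<^sup>2))\<^sup>2"
      by (intro power_mono) auto
    then have "(norm \<phi>)\<^sup>2 \<le> (norm \<phi>)\<^sup>2 - \<epsilon>\<^sup>2"
      using nn by simp
    with \<epsilon> show False by simp
  qed
  then obtain F where F: "finite F" "(norm \<phi>)\<^sup>2 - \<epsilon>\<^sup>2 < (\<Sum>x\<in>F. ?q x)"
    by blast
  have "norm (\<phi> - (\<Sum>y\<in>F. ell2_site y (ell2_apply \<phi> y))) \<le> \<epsilon>" (is "norm ?d \<le> \<epsilon>")
  proof (rule norm_ell2_le_finite_sums)
    fix G :: "'a set" assume G: "finite G"
    have "(\<Sum>x\<in>G. (cmod (ell2_apply ?d x))\<^sup>2) = (\<Sum>x\<in>G. if x \<in> F then 0 else ?q x)"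
      using F by (intro sum.cong) (auto simp: ell2_apply_simps ell2_apply_sum_sites)
    also have "\<dots> = (\<Sum>x\<in>G - F. ?q x)"
      using G by (intro sum.mono_neutral_cong_right) auto
    also have "\<dots> = (\<Sum>x\<in>G \<union> F. ?q x) - (\<Sum>x\<in>F. ?q x)"
      using F G sum.union_disjoint[of "G - F" F ?q] by (auto simp: Int_Diff_disjoint Diff_disjoint Int_commute)
    also have "\<dots> \<le> \<epsilon>\<^sup>2"
      using F G sum_le_norm_ell2[of "G \<union> F" \<phi>] by simp
    finally show "(\<Sum>x\<in>G. (cmod (ell2_apply ?d x))\<^sup>2) \<le> \<epsilon>\<^sup>2" .
  qed (use \<epsilon> in simp)
  with F that show ?thesis by blast
qed

text \<open>For a uniformly bounded sequence of operators, strong convergence may be tested on a set whose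
  span is dense.  The value \<open>c\<close> at the site \<open>y\<close> varies as well because the operators are
  only real-linear.\<close>

lemma tendsto_zero_if_on_sites:
  fixes Y :: "nat \<Rightarrow> 'a op"
  assumes bound: "\<And>n. norm (Y n) \<le> C"
    and sites: "\<And>y c. (\<lambda>n. Y n (ell2_site y c)) \<longlonglongrightarrow> 0"
  shows "(\<lambda>n. Y n \<phi>) \<longlonglongrightarrow> 0"
proof (rule LIMSEQ_I)
  fix \<epsilon> :: real assume \<epsilon>: "\<epsilon> > 0"
  have C: "0 \<le> C" using norm_ge_zero[of "Y 0"] bound[of 0] by linarith
  define \<delta> where "\<delta> = \<epsilon> / (2 * (C + 1))"
  have \<delta>: "\<delta> > 0" using \<epsilon> C by (simp add: \<delta>_def)
  have "C * \<delta> \<le> (C + 1) * \<delta>"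
    using \<delta> by simp
  also have "\<dots> = \<epsilon> / 2"
    using C by (simp add: \<delta>_def divide_simps)
  finally have C\<delta>: "C * \<delta> \<le> \<epsilon> / 2" .
  obtain F where F: "finite F" "norm (\<phi> - (\<Sum>y\<in>F. ell2_site y (ell2_apply \<phi> y))) \<le> \<delta>"
    by (rule sum_sites_dense[OF \<delta>])
  let ?s = "\<Sum>y\<in>F. ell2_site y (ell2_apply \<phi> y)"
  have "(\<lambda>n. Y n ?s) \<longlonglongrightarrow> (\<Sum>y\<in>F. 0)"
    unfolding blinfun.sum_right by (intro tendsto_sum sites)
  then obtain M where M: "\<forall>n\<ge>M. norm (Y n ?s) < \<epsilon> / 2"
    using LIMSEQ_D[of "\<lambda>n. Y n ?s" 0 "\<epsilon>/2"] \<epsilon> by auto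
  have "norm (Y n \<phi> - 0) < \<epsilon>" if "n \<ge> M" for n
  proof -
    have "norm (Y n (\<phi> - ?s)) \<le> C * \<delta>"
      using norm_blinfun[of "Y n" "\<phi> - ?s"] mult_mono[OF bound[of n] F(2) C norm_ge_zero]
      by linarith
    then have "norm (Y n (\<phi> - ?s) + Y n ?s) < \<epsilon>"
      using M that C\<delta> norm_triangle_ineq[of "Y n (\<phi> - ?s)" "Y n ?s"] by fastforce
    then show ?thesis
      by (simp add: blinfun.diff_right)
  qed
  then show "\<exists>M. \<forall>n\<ge>M. norm (Y n \<phi> - 0) < \<epsilon>" by blast
qed

section \<open>Operators, weighted shifts and cutoffs\<close>

lemma bounded_opsD: "T \<in> bounded_ops \<Longrightarrow> T (ell2_scale c \<phi>) = ell2_scale c (T \<phi>)"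
  by (simp add: bounded_ops_def)

lemma bounded_ops_add: "X \<in> bounded_ops \<Longrightarrow> Y \<in> bounded_ops \<Longrightarrow> X + Y \<in> bounded_ops"
  and bounded_ops_diff: "X \<in> bounded_ops \<Longrightarrow> Y \<in> bounded_ops \<Longrightarrow> X - Y \<in> bounded_ops"
  and bounded_ops_compose: "X \<in> bounded_ops \<Longrightarrow> Y \<in> bounded_ops \<Longrightarrow> X o\<^sub>L Y \<in> bounded_ops"
  and bounded_ops_zero: "0 \<in> bounded_ops"
  and bounded_ops_id: "id_blinfun \<in> bounded_ops"
  and bounded_ops_op_scale: "X \<in> bounded_ops \<Longrightarrow> op_scale c X \<in> bounded_ops"
  by (auto simp: bounded_ops_def blinfun.bilinear_simps ell2_scale_add ell2_scale_diff op_scale_apply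
      intro!: ell2_eqI simp: ell2_apply_simps)

lemma closed_bounded_ops: "closed (bounded_ops :: 'a op set)"
proof -
  have eq: "bounded_ops = (\<Inter>c. \<Inter>\<phi>. {T :: 'a op. T (ell2_scale c \<phi>) = ell2_scale c (T \<phi>)})"
    by (auto simp: bounded_ops_def)
  moreover have "closed {T :: 'a op. T (ell2_scale c \<phi>) = ell2_scale c (T \<phi>)}" for c \<phi>
    by (intro closed_Collect_eq continuous_intros
        linear_continuous_on_compose[OF _ bounded_linear.linear]
        bounded_linear.continuous_on[OF bounded_linear_ell2_scale])
  ultimately show ?thesis
    unfolding eq by (intro closed_INT ballI)
qed

definition scalar_op :: "complex \<Rightarrow> 'a op" where
  "scalar_op z = op_scale z id_blinfun"

lemma scalar_op_apply: "scalar_op z \<phi> = ell2_scale z \<phi>"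
  by (simp add: scalar_op_def op_scale_apply)

lemma scalar_op_commute: "T \<in> bounded_ops \<Longrightarrow> T o\<^sub>L scalar_op z = scalar_op z o\<^sub>L T"
  by (auto intro!: blinfun_eqI simp: scalar_op_apply bounded_opsD)

lemma op_scale_eq_compose: "op_scale z T = scalar_op z o\<^sub>L T"
  by (auto intro!: blinfun_eqI simp: scalar_op_apply op_scale_apply)

lemma scalar_op_bounded_ops: "scalar_op z \<in> bounded_ops"
  by (simp add: scalar_op_def bounded_ops_op_scale bounded_ops_id)

text \<open>Finite-range lattice operators, cutoffs and their commutators are all sums of operators of the
  following form, whose norm is controlled by the supremum of the weight.\<close>

definition weighted_shift :: "('d::finite lattice \<Rightarrow> complex) \<Rightarrow> 'd lattice \<Rightarrow> 'd lattice op" where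
  "weighted_shift g v = Blinfun (\<lambda>\<phi>. Abs_ell2 (\<lambda>x. g x * ell2_apply \<phi> (x + v)))"

lemma
  fixes g :: "'d::finite lattice \<Rightarrow> complex"
  assumes g: "\<And>x. cmod (g x) \<le> C"
  shows weighted_shift_apply: "ell2_apply (weighted_shift g v \<phi>) x = g x * ell2_apply \<phi> (x + v)"
    and norm_weighted_shift_le: "norm (weighted_shift g v) \<le> C"
    and weighted_shift_bounded_ops: "weighted_shift g v \<in> bounded_ops"
proof -
  define W where "W \<phi> = Abs_ell2 (\<lambda>x. g x * ell2_apply \<phi> (x + v))" for \<phi>
  have C: "0 \<le> C" using g[of 0] norm_ge_zero[of "g 0"] by linarith
  have W: "ell2_apply (W \<phi>) = (\<lambda>x. g x * ell2_apply \<phi> (x + v)) \<and> norm (W \<phi>) \<le> C * norm \<phi>" for \<phi>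
  proof (rule ell2_of_dominated[of "\<lambda>x. x + v" C "\<lambda>x. g x * ell2_apply \<phi> (x + v)" \<phi>])
    show "cmod (g x * ell2_apply \<phi> (x + v)) \<le> C * cmod (ell2_apply \<phi> (x + v))" for x
      using g by (simp add: norm_mult mult_right_mono)
    fix \<psi> assume "ell2_apply \<psi> = (\<lambda>x. g x * ell2_apply \<phi> (x + v))" "norm \<psi> \<le> C * norm \<phi>"
    then show ?thesis by (metis W_def ell2_apply_inverse)
  qed (use C in auto)
  have "bounded_linear W"
  proof (rule bounded_linear_intro[where K = C])
    show "W (\<phi> + \<psi>) = W \<phi> + W \<psi>" for \<phi> \<psi>
      by (rule ell2_eqI) (simp add: W ell2_apply_simps algebra_simps)
    show "W (r *\<^sub>R \<phi>) = r *\<^sub>R W \<phi>" for r \<phi>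
      by (rule ell2_eqI) (simp add: W ell2_apply_simps algebra_simps)
    show "norm (W \<phi>) \<le> norm \<phi> * C" for \<phi>
      using W by (simp add: mult.commute)
  qed
  then have eq: "blinfun_apply (weighted_shift g v) = W"
    unfolding weighted_shift_def W_def[abs_def] by (rule bounded_linear_Blinfun_apply)
  show a: "ell2_apply (weighted_shift g v \<phi>) x = g x * ell2_apply \<phi> (x + v)" for \<phi> x
    by (simp add: eq W)
  show "norm (weighted_shift g v) \<le> C"
    by (rule norm_blinfun_bound[OF C]) (simp add: eq W)
  show "weighted_shift g v \<in> bounded_ops"
    by (auto simp: bounded_ops_def a ell2_apply_simps intro!: ell2_eqI)
qed

lemma half_space_proj_compose:
  "n \<le> m \<Longrightarrow> half_space_proj e m o\<^sub>L half_space_proj e n = half_space_proj e n"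
  "n \<le> m \<Longrightarrow> half_space_proj e n o\<^sub>L half_space_proj e m = half_space_proj e n"
  by (auto simp: half_space_proj_apply intro!: op_eqI)

lemma norm_translation_apply: "norm (translation e k \<phi>) = norm \<phi>"
  by (simp add: translation_def bounded_linear_Blinfun_apply[OF bounded_linear_ell2_shift]
      norm_ell2_shift)

lemma norm_translation_le: "norm (translation e k) \<le> 1"
  by (rule norm_blinfun_bound) (simp_all add: norm_translation_apply)

lemma axis_add: "axis e (j + k) = axis e j + (axis e k :: int ^ 'd::finite)"
  by (auto simp: vec_eq_iff axis_def)

lemma translation_compose: "translation e j o\<^sub>L translation e k = translation e (j + k)"
  by (auto intro!: op_eqI simp: translation_apply axis_add algebra_simps)

lemma translation_0: "translation e 0 = id_blinfun"
  by (auto intro!: op_eqI simp: translation_apply axis_def zero_vec_def[symmetric] vec_eq_iff)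

lemma translation_site:
  "translation e k (ell2_site y c) = ell2_site (y - axis e k) c"
  by (rule ell2_eqI) (auto simp: translation_apply ell2_site.rep_eq)

text \<open>The cutoff equals \<open>1\<close> on the half-space of \<open>p\<^sub>n\<close>, vanishes outside
  that of \<open>p\<^sub>n\<^sub>+\<^sub>N\<close>, and decreases linearly in between.  Its small slope
  \<open>1 / N\<close> makes it almost commute with finite-range operators, which a sharp projection does not.\<close>

definition ramp :: "'d::finite \<Rightarrow> nat \<Rightarrow> nat \<Rightarrow> 'd lattice \<Rightarrow> real" where
  "ramp e n N x = max 0 (min 1 (real_of_int (x $ e + int n + int N) / real N))"

definition cutoff :: "'d::finite \<Rightarrow> nat \<Rightarrow> nat \<Rightarrow> 'd lattice op" where
  "cutoff e n N = weighted_shift (\<lambda>x. complex_of_real (ramp e n N x)) 0"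

lemma ramp_range: "0 \<le> ramp e n N x" "ramp e n N x \<le> 1"
  by (auto simp: ramp_def)

lemma ramp_eq_1: "N \<ge> 1 \<Longrightarrow> - int n \<le> x $ e \<Longrightarrow> ramp e n N x = 1"
  by (auto simp: ramp_def divide_simps)

lemma ramp_eq_0:
  assumes "\<not> - int (n + N) \<le> x $ e"
  shows "ramp e n N x = 0"
proof -
  have "real_of_int (x $ e + int n + int N) \<le> 0"
    using assms by linarith
  then have "real_of_int (x $ e + int n + int N) / real N \<le> 0"
    by (rule divide_nonpos_nonneg) simp
  then show ?thesis
    by (simp add: ramp_def)
qed

lemma ramp_lipschitz:
  assumes "N \<ge> 1"
  shows "\<bar>ramp e n N (x + v) - ramp e n N x\<bar> \<le> \<bar>real_of_int (v $ e)\<bar> / real N"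
proof -
  have clip: "\<bar>max 0 (min 1 s) - max 0 (min 1 t)\<bar> \<le> \<bar>s - t\<bar>" for s t :: real
    by (auto simp: max_def min_def)
  show ?thesis
    unfolding ramp_def
    by (rule order_trans[OF clip]) (simp add: diff_divide_distrib[symmetric])
qed

lemma cutoff_apply: "ell2_apply (cutoff e n N \<phi>) x = complex_of_real (ramp e n N x) * ell2_apply \<phi> x"
  unfolding cutoff_def
  by (subst weighted_shift_apply[where C = 1]) (auto simp: ramp_range abs_le_iff)

lemma cutoff_bounded_ops: "cutoff e n N \<in> bounded_ops"
  unfolding cutoff_def
  by (rule weighted_shift_bounded_ops[where C = 1]) (auto simp: ramp_range)

lemma cutoff_compose_half_space_proj:
  assumes "N \<ge> 1"
  shows "cutoff e n N o\<^sub>L half_space_proj e n = half_space_proj e n"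
    and "half_space_proj e n o\<^sub>L cutoff e n N = half_space_proj e n"
  using assms by (auto intro!: op_eqI simp: cutoff_apply half_space_proj_apply ramp_eq_1)

lemma half_space_proj_compose_cutoff:
  "half_space_proj e (n + N) o\<^sub>L cutoff e n N = cutoff e n N"
  "cutoff e n N o\<^sub>L half_space_proj e (n + N) = cutoff e n N"
  using ramp_eq_0[of n N _ e]
  by (auto intro!: op_eqI simp: cutoff_apply half_space_proj_apply)

section \<open>Operators that almost commute with slow cutoffs\<close>

abbreviation commutator :: "'a op \<Rightarrow> 'a op \<Rightarrow> 'a op" where
  "commutator S T \<equiv> (S o\<^sub>L T) - (T o\<^sub>L S)"

definition almost_commutes_with_cutoffs :: "'d::finite \<Rightarrow> 'd lattice op \<Rightarrow> bool" where
  "almost_commutes_with_cutoffs e T \<longleftrightarrow>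
     (\<forall>n. (\<lambda>N. commutator T (cutoff e n N)) \<longlonglongrightarrow> 0)"

text \<open>The commutator of a finite-range operator with the cutoff is again of finite range, and its
  coefficients contain the increments of the ramp, which are of order \<open>1 / N\<close>.\<close>

lemma finite_range_almost_commutes:
  fixes e :: "'d::finite" and a :: "'i \<Rightarrow> 'd lattice \<Rightarrow> complex" and A :: "'d lattice op"
  assumes a: "\<And>r. r \<in> R \<Longrightarrow> bounded (range (a r))"
    and A: "\<And>\<phi> x. ell2_apply (A \<phi>) x = (\<Sum>r\<in>R. a r x * ell2_apply \<phi> (x + b r))"
  shows "almost_commutes_with_cutoffs e A"
  unfolding almost_commutes_with_cutoffs_def
proof
  fix n
  have "\<exists>M. \<forall>r\<in>R. \<forall>x. cmod (a r x) \<le> M r"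
    using a by (intro bchoice) (auto simp: bounded_iff)
  then obtain M where M: "\<And>r x. r \<in> R \<Longrightarrow> cmod (a r x) \<le> M r"
    by metis
  define K where "K = (\<Sum>r\<in>R. M r * \<bar>real_of_int (b r $ e)\<bar>)"
  show "(\<lambda>N. commutator A (cutoff e n N)) \<longlonglongrightarrow> 0"
  proof (rule Lim_null_comparison)
    show "(\<lambda>N. K / real N) \<longlonglongrightarrow> 0"
      by (rule lim_const_over_n)
    show "\<forall>\<^sub>F N in sequentially. norm (commutator A (cutoff e n N)) \<le> K / real N"
    proof (rule eventually_sequentiallyI[of 1])
      fix N :: nat assume N: "1 \<le> N"
      let ?g = "\<lambda>r x. a r x * complex_of_real (ramp e n N (x + b r) - ramp e n N x)"
      have g: "cmod (?g r x) \<le> M r * (\<bar>real_of_int (b r $ e)\<bar> / real N)" if "r \<in> R" for r x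
        unfolding norm_mult norm_of_real using M[OF that] ramp_lipschitz[OF N]
        by (intro mult_mono order_trans[OF norm_ge_zero M[OF that]]) auto
      have "commutator A (cutoff e n N) = (\<Sum>r\<in>R. weighted_shift (?g r) (b r))"
      proof (rule op_eqI)
        fix \<phi> x
        have "ell2_apply ((\<Sum>r\<in>R. weighted_shift (?g r) (b r)) \<phi>) x
            = (\<Sum>r\<in>R. ?g r x * ell2_apply \<phi> (x + b r))"
          unfolding blinfun.sum_left ell2_apply_sum
          by (intro sum.cong refl weighted_shift_apply[OF g])
        then show "ell2_apply ((commutator A (cutoff e n N)) \<phi>) x
            = ell2_apply ((\<Sum>r\<in>R. weighted_shift (?g r) (b r)) \<phi>) x"
          by (simp add: blinfun.diff_left ell2_apply_simps A cutoff_apply sum_distrib_left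
              sum_subtractf algebra_simps)
      qed
      also have "norm \<dots> \<le> (\<Sum>r\<in>R. M r * (\<bar>real_of_int (b r $ e)\<bar> / real N))"
        by (intro sum_norm_le norm_weighted_shift_le g)
      also have "\<dots> = K / real N"
        by (simp add: K_def sum_divide_distrib)
      finally show "norm (commutator A (cutoff e n N)) \<le> K / real N" .
    qed
  qed
qed

lemma scalar_op_almost_commutes: "almost_commutes_with_cutoffs e (scalar_op z)"
  by (simp add: almost_commutes_with_cutoffs_def scalar_op_commute[OF cutoff_bounded_ops])

lemma almost_commutes_diff:
  assumes "almost_commutes_with_cutoffs e S" "almost_commutes_with_cutoffs e T"
  shows "almost_commutes_with_cutoffs e (S - T)"
  unfolding almost_commutes_with_cutoffs_def
proof
  fix n
  have "(\<lambda>N. (commutator S (cutoff e n N)) - (commutator T (cutoff e n N))) \<longlonglongrightarrow> 0 - 0"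
    using assms unfolding almost_commutes_with_cutoffs_def by (intro tendsto_diff) auto
  then show "(\<lambda>N. commutator (S - T) (cutoff e n N)) \<longlonglongrightarrow> 0"
    by (simp add: bounded_bilinear.diff_left[OF bounded_bilinear_blinfun_compose]
        bounded_bilinear.diff_right[OF bounded_bilinear_blinfun_compose] algebra_simps)
qed

text \<open>With \<open>K\<^sub>1 = K\<^sub>2 = 0\<close> this is the usual formula for the commutator of an inverse; in
  general \<open>G\<close> is an inverse only up to the errors \<open>K\<^sub>1\<close> and \<open>K\<^sub>2\<close>.\<close>

lemma commutator_quasi_inverse:
  fixes D G F K1 K2 :: "'a op"
  assumes "D o\<^sub>L G = id_blinfun + K1" "G o\<^sub>L D = id_blinfun + K2"
  shows "commutator F G
    = (G o\<^sub>L commutator D F o\<^sub>L G) + ((G o\<^sub>L F o\<^sub>L K1) - (K2 o\<^sub>L F o\<^sub>L G))"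
proof (rule blinfun_eqI)
  fix \<phi>
  have 1: "D (G \<psi>) = \<psi> + K1 \<psi>" "G (D \<psi>) = \<psi> + K2 \<psi>" for \<psi>
    using assms[THEN arg_cong, of "\<lambda>T. blinfun_apply T \<psi>"] by (simp_all add: blinfun.add_left)
  show "(commutator F G) \<phi>
    = ((G o\<^sub>L commutator D F o\<^sub>L G) + ((G o\<^sub>L F o\<^sub>L K1) - (K2 o\<^sub>L F o\<^sub>L G))) \<phi>"
    by (simp add: blinfun.bilinear_simps 1 algebra_simps)
qed

text \<open>This is what keeps resolvents inside the idealizer of the half-space ideal: the commutator of the
  inverse is squeezed between two bounded factors.\<close>

lemma inverse_almost_commutes:
  assumes D: "almost_commutes_with_cutoffs e D"
    and DG: "D o\<^sub>L G = id_blinfun" and GD: "G o\<^sub>L D = id_blinfun"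
  shows "almost_commutes_with_cutoffs e G"
  unfolding almost_commutes_with_cutoffs_def
proof
  fix n
  have comm: "commutator G (cutoff e n N)
      = - (G o\<^sub>L (commutator D (cutoff e n N)) o\<^sub>L G)" for N
    using commutator_quasi_inverse[of D G 0 0 "cutoff e n N"] DG GD
    by (simp add: minus_equation_iff[symmetric] algebra_simps)
  have "(\<lambda>N. - (G o\<^sub>L (commutator D (cutoff e n N)) o\<^sub>L G)) \<longlonglongrightarrow> - (G o\<^sub>L 0 o\<^sub>L G)"
    using D unfolding almost_commutes_with_cutoffs_def
    by (intro tendsto_minus bounded_bilinear.tendsto[OF bounded_bilinear_blinfun_compose] tendsto_const) auto
  then show "(\<lambda>N. commutator G (cutoff e n N)) \<longlonglongrightarrow> 0"
    by (simp add: comm)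
qed

section \<open>Spectra modulo an ideal of operators\<close>

text \<open>Containing all scalar operators makes these sets closed under negation and complex multiples,
  and their ideals are then closed under complex multiples as well.\<close>

definition operator_algebra :: "'a op set \<Rightarrow> bool" where
  "operator_algebra S \<longleftrightarrow> S \<subseteq> bounded_ops \<and> range scalar_op \<subseteq> S \<and>
     (\<forall>X\<in>S. \<forall>Y\<in>S. X + Y \<in> S \<and> X o\<^sub>L Y \<in> S)"

definition operator_ideal :: "'a op set \<Rightarrow> 'a op set \<Rightarrow> bool" where
  "operator_ideal I S \<longleftrightarrow> I \<subseteq> S \<and> 0 \<in> I \<and> (\<forall>X\<in>I. \<forall>Y\<in>I. X + Y \<in> I) \<and>
     (\<forall>X\<in>I. \<forall>T\<in>S. T o\<^sub>L X \<in> I \<and> X o\<^sub>L T \<in> I)"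

lemma op_algebra_simps:
  "carrier (op_algebra S) = S" "mult (op_algebra S) = (o\<^sub>L)" "one (op_algebra S) = id_blinfun"
  "zero (op_algebra S) = 0" "add (op_algebra S) = (+)" "smult (op_algebra S) = op_scale"
  by (simp_all add: op_algebra_def)

lemma scalar_op_simps: "scalar_op 1 = id_blinfun" "scalar_op 0 = 0" "scalar_op (-1) o\<^sub>L X = - X"
  by (auto intro!: op_eqI simp: scalar_op_apply ell2_apply_simps blinfun.minus_left uminus_ell2.rep_eq)

lemmas compose_add_left = bounded_bilinear.add_left[OF bounded_bilinear_blinfun_compose]
lemmas compose_add_right = bounded_bilinear.add_right[OF bounded_bilinear_blinfun_compose]
lemmas compose_diff_left = bounded_bilinear.diff_left[OF bounded_bilinear_blinfun_compose]
lemmas compose_diff_right = bounded_bilinear.diff_right[OF bounded_bilinear_blinfun_compose]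

lemma compose_assoc: "(X o\<^sub>L Y) o\<^sub>L Z = X o\<^sub>L (Y o\<^sub>L Z)"
  by (rule blinfun_eqI) simp

lemma operator_algebraD:
  assumes "operator_algebra S"
  shows "scalar_op z \<in> S" "0 \<in> S" "id_blinfun \<in> S"
    and "X \<in> S \<Longrightarrow> Y \<in> S \<Longrightarrow> X + Y \<in> S" "X \<in> S \<Longrightarrow> Y \<in> S \<Longrightarrow> X o\<^sub>L Y \<in> S"
    and "X \<in> S \<Longrightarrow> - X \<in> S" "X \<in> S \<Longrightarrow> Y \<in> S \<Longrightarrow> X - Y \<in> S"
proof -
  have s: "scalar_op z \<in> S" and plus: "X \<in> S \<Longrightarrow> Y \<in> S \<Longrightarrow> X + Y \<in> S"
    and comp: "X \<in> S \<Longrightarrow> Y \<in> S \<Longrightarrow> X o\<^sub>L Y \<in> S" for z X Y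
    using assms by (auto simp: operator_algebra_def)
  show "scalar_op z \<in> S" "X \<in> S \<Longrightarrow> Y \<in> S \<Longrightarrow> X + Y \<in> S" "X \<in> S \<Longrightarrow> Y \<in> S \<Longrightarrow> X o\<^sub>L Y \<in> S"
    by (fact s plus comp)+
  show "0 \<in> S" "id_blinfun \<in> S"
    using s[of 0] s[of 1] by (simp_all add: scalar_op_simps)
  have m: "X \<in> S \<Longrightarrow> - X \<in> S" for X
    using comp[OF s[of "-1"], of X] by (simp add: scalar_op_simps)
  then show "X \<in> S \<Longrightarrow> - X \<in> S" .
  show "X \<in> S \<Longrightarrow> Y \<in> S \<Longrightarrow> X - Y \<in> S"
    using plus[OF _ m, of X Y] by simp
qed

lemma operator_algebra_ring:
  assumes S: "operator_algebra S"
  shows "ring (op_algebra S)"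
proof (rule ringI)
  show "abelian_group (op_algebra S)"
  proof (rule abelian_groupI)
    fix X assume "X \<in> carrier (op_algebra S)"
    then show "\<exists>Y\<in>carrier (op_algebra S). Y \<oplus>\<^bsub>op_algebra S\<^esub> X = \<zero>\<^bsub>op_algebra S\<^esub>"
      by (intro bexI[of _ "- X"]) (auto simp: op_algebra_simps operator_algebraD[OF S])
  qed (auto simp: op_algebra_simps operator_algebraD[OF S])
  show "Group.monoid (op_algebra S)"
    by (rule monoidI) (auto simp: op_algebra_simps operator_algebraD[OF S] compose_assoc intro!: blinfun_eqI)
qed (auto simp: op_algebra_simps compose_add_left compose_add_right)

lemma op_algebra_minus:
  assumes S: "operator_algebra S" and X: "X \<in> S" "Y \<in> S"
  shows "X \<ominus>\<^bsub>op_algebra S\<^esub> Y = X - Y"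
proof -
  interpret ring "op_algebra S" by (rule operator_algebra_ring[OF S])
  have "\<ominus>\<^bsub>op_algebra S\<^esub> Y = - Y"
    using X by (intro minus_equality) (auto simp: op_algebra_simps operator_algebraD[OF S])
  then show ?thesis
    by (simp add: a_minus_def op_algebra_simps)
qed

lemma operator_ideal_ideal:
  assumes S: "operator_algebra S" and I: "operator_ideal I S"
  shows "ideal I (op_algebra S)"
proof (rule idealI)
  interpret ring "op_algebra S" by (rule operator_algebra_ring[OF S])
  have neg: "\<ominus>\<^bsub>op_algebra S\<^esub> X = - X" if "X \<in> S" for X
    using that by (intro minus_equality) (auto simp: op_algebra_simps operator_algebraD[OF S])
  have IS: "I \<subseteq> S"
    using I by (simp add: operator_ideal_def)
  have "- X \<in> I" if "X \<in> I" for X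
    using I that operator_algebraD(1)[OF S, of "-1"]
    by (auto simp: operator_ideal_def scalar_op_simps(3)[symmetric])
  with IS have "\<ominus>\<^bsub>op_algebra S\<^esub> X \<in> I" if "X \<in> I" for X
    using that neg[of X] by auto
  then show "subgroup I (add_monoid (op_algebra S))"
    using I
    by (intro add.subgroupI) (auto simp: op_algebra_simps operator_ideal_def a_inv_def[symmetric])
qed (use I operator_algebra_ring[OF S] in \<open>auto simp: op_algebra_simps operator_ideal_def\<close>)

lemma operator_algebra_bounded_ops: "operator_algebra bounded_ops"
  by (auto simp: operator_algebra_def scalar_op_bounded_ops bounded_ops_add bounded_ops_compose)

lemma not_in_op_spectrum_iff:
  assumes T: "T \<in> bounded_ops"
  shows "z \<notin> op_spectrum T \<longleftrightarrow>
    (\<exists>R\<in>bounded_ops. (T - scalar_op z) o\<^sub>L R = id_blinfun \<and> R o\<^sub>L (T - scalar_op z) = id_blinfun)"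
  using bounded_ops_diff[OF T scalar_op_bounded_ops[of z]]
  by (auto simp: op_spectrum_def spectrum_def Units_def op_algebra_simps scalar_op_def[symmetric]
      op_algebra_minus[OF operator_algebra_bounded_ops T scalar_op_bounded_ops])

lemma quotient_algebra_simps:
  fixes R :: "(complex, 'b, 'm) module_scheme"
  shows "carrier (quotient_algebra R I) = carrier (R Quot I)"
    "mult (quotient_algebra R I) = mult (R Quot I)" "one (quotient_algebra R I) = one (R Quot I)"
    "zero (quotient_algebra R I) = zero (R Quot I)" "add (quotient_algebra R I) = add (R Quot I)"
    "smult (quotient_algebra R I) = (\<lambda>z X. \<Union>x\<in>X. I +>\<^bsub>R\<^esub> (z \<odot>\<^bsub>R\<^esub> x))"
  by (simp_all add: quotient_algebra_def ring.extend_def module.fields_def)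

text \<open>Cosets are multiplied by scalars through scalar operators, so \<open>z\<close> times the unit of the
  quotient is the coset of \<open>scalar_op z\<close>.  A coset is then a unit exactly if a representative has
  an inverse up to errors in \<open>I\<close>.\<close>

lemma not_in_quotient_spectrum_iff:
  assumes S: "operator_algebra S" and I: "operator_ideal I S" and X: "X \<in> S"
  shows "z \<notin> quotient_spectrum (op_algebra S) I X \<longleftrightarrow>
    (\<exists>G\<in>S. ((X - scalar_op z) o\<^sub>L G) - id_blinfun \<in> I \<and> (G o\<^sub>L (X - scalar_op z)) - id_blinfun \<in> I)"
proof -
  let ?R = "op_algebra S" and ?Q = "quotient_algebra (op_algebra S) I"
  note S_closed = operator_algebraD[OF S]
  interpret ideal I ?R by (rule operator_ideal_ideal[OF S I])
  interpret Q: ring "?R Quot I" by (rule quotient_is_ring)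
  interpret h: ring_hom_ring ?R "?R Quot I" "(+>\<^bsub>?R\<^esub>) I" by (rule rcos_ring_hom_ring)
  have coset_eq: "I +>\<^bsub>?R\<^esub> Y = I +>\<^bsub>?R\<^esub> Z \<longleftrightarrow> Y - Z \<in> I" if "Y \<in> S" "Z \<in> S" for Y Z
    using quotient_eq_iff_same_a_r_cos[OF ideal_axioms, of Y Z] that
    by (simp add: op_algebra_simps op_algebra_minus[OF S])
  have inv: "a_inv ?Q = a_inv (?R Quot I)"
    by (simp add: a_inv_def m_inv_def quotient_algebra_simps fun_eq_iff)
  have scalar: "z \<odot>\<^bsub>?Q\<^esub> \<one>\<^bsub>?Q\<^esub> = I +>\<^bsub>?R\<^esub> scalar_op z"
  proof -
    have one: "\<one>\<^bsub>?Q\<^esub> = I +>\<^bsub>?R\<^esub> id_blinfun"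
      by (simp add: quotient_algebra_simps FactRing_def op_algebra_simps)
    have "I +>\<^bsub>?R\<^esub> op_scale z Y = I +>\<^bsub>?R\<^esub> scalar_op z" if Y: "Y \<in> I +>\<^bsub>?R\<^esub> id_blinfun" for Y
    proof -
      from Y obtain i where i: "i \<in> I" "Y = i + id_blinfun"
        by (auto simp: a_r_coset_def r_coset_def op_algebra_simps)
      then have "op_scale z Y - scalar_op z = scalar_op z o\<^sub>L i"
        by (simp add: op_scale_eq_compose compose_add_right) (auto intro!: blinfun_eqI simp: blinfun.bilinear_simps)
      moreover have "scalar_op z o\<^sub>L i \<in> I"
        using I i S_closed(1) by (auto simp: operator_ideal_def)
      moreover have "op_scale z Y \<in> S"
        using i I S_closed by (auto simp: op_scale_eq_compose operator_ideal_def)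
      ultimately show ?thesis
        using S_closed(1) by (simp add: coset_eq)
    qed
    moreover have "id_blinfun \<in> I +>\<^bsub>?R\<^esub> id_blinfun"
      using a_rcos_self[of id_blinfun] S_closed by (simp add: op_algebra_simps)
    ultimately show ?thesis
      unfolding quotient_algebra_simps(6) one op_algebra_simps by auto
  qed
  define D where "D = X - scalar_op z"
  have D: "D \<in> S" using X S_closed by (simp add: D_def)
  have "(I +>\<^bsub>?R\<^esub> X) \<ominus>\<^bsub>?Q\<^esub> (z \<odot>\<^bsub>?Q\<^esub> \<one>\<^bsub>?Q\<^esub>) = (I +>\<^bsub>?R\<^esub> X) \<ominus>\<^bsub>?R Quot I\<^esub> (I +>\<^bsub>?R\<^esub> scalar_op z)"
    unfolding a_minus_def scalar inv by (simp add: quotient_algebra_simps)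
  also have "\<dots> = I +>\<^bsub>?R\<^esub> (X \<ominus>\<^bsub>?R\<^esub> scalar_op z)"
    using X S_closed(1) h.hom_add[of X "\<ominus>\<^bsub>?R\<^esub> scalar_op z"] h.hom_a_inv[of "scalar_op z"]
      a_inv_closed[of "scalar_op z"]
    by (simp add: a_minus_def op_algebra_simps)
  also have "\<dots> = I +>\<^bsub>?R\<^esub> D"
    using X S_closed(1) by (simp add: op_algebra_minus[OF S] D_def)
  finally have "z \<notin> quotient_spectrum ?R I X \<longleftrightarrow> I +>\<^bsub>?R\<^esub> D \<in> Units ?Q"
    by (simp add: quotient_spectrum_def spectrum_def)
  also have "\<dots> \<longleftrightarrow> (\<exists>G\<in>S. (I +>\<^bsub>?R\<^esub> D) \<otimes>\<^bsub>?R Quot I\<^esub> (I +>\<^bsub>?R\<^esub> G) = \<one>\<^bsub>?R Quot I\<^esub>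
      \<and> (I +>\<^bsub>?R\<^esub> G) \<otimes>\<^bsub>?R Quot I\<^esub> (I +>\<^bsub>?R\<^esub> D) = \<one>\<^bsub>?R Quot I\<^esub>)"
    using h.hom_closed[of D] D
    by (auto simp: Units_def quotient_algebra_simps op_algebra_simps) (auto simp: FactRing_def A_RCOSETS_def' op_algebra_simps)
  also have "\<dots> \<longleftrightarrow> (\<exists>G\<in>S. (D o\<^sub>L G) - id_blinfun \<in> I \<and> (G o\<^sub>L D) - id_blinfun \<in> I)"
  proof (rule bex_cong[OF refl])
    fix G assume G: "G \<in> S"
    have "(I +>\<^bsub>?R\<^esub> Y) \<otimes>\<^bsub>?R Quot I\<^esub> (I +>\<^bsub>?R\<^esub> Z) = \<one>\<^bsub>?R Quot I\<^esub>
        \<longleftrightarrow> (Y o\<^sub>L Z) - id_blinfun \<in> I" if "Y \<in> S" "Z \<in> S" for Y Z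
    proof -
      have "(I +>\<^bsub>?R\<^esub> Y) \<otimes>\<^bsub>?R Quot I\<^esub> (I +>\<^bsub>?R\<^esub> Z) = I +>\<^bsub>?R\<^esub> (Y o\<^sub>L Z)"
        using h.hom_mult[of Y Z] that by (simp add: op_algebra_simps)
      moreover have "\<one>\<^bsub>?R Quot I\<^esub> = I +>\<^bsub>?R\<^esub> id_blinfun"
        by (simp add: FactRing_def op_algebra_simps)
      ultimately show ?thesis
        using that S_closed by (simp add: coset_eq)
    qed
    then show "((I +>\<^bsub>?R\<^esub> D) \<otimes>\<^bsub>?R Quot I\<^esub> (I +>\<^bsub>?R\<^esub> G) = \<one>\<^bsub>?R Quot I\<^esub>
      \<and> (I +>\<^bsub>?R\<^esub> G) \<otimes>\<^bsub>?R Quot I\<^esub> (I +>\<^bsub>?R\<^esub> D) = \<one>\<^bsub>?R Quot I\<^esub>)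
      \<longleftrightarrow> ((D o\<^sub>L G) - id_blinfun \<in> I \<and> (G o\<^sub>L D) - id_blinfun \<in> I)"
      using G D by simp
  qed
  finally show ?thesis unfolding D_def .
qed

section \<open>The ideal of compact operators\<close>

lemma compact_opsI:
  assumes "T \<in> bounded_ops" "compact C" "T ` cball 0 1 \<subseteq> C"
  shows "T \<in> compact_ops"
proof -
  have "closure (T ` cball 0 1) \<subseteq> C"
    using assms by (intro closure_minimal compact_imp_closed)
  then have "closure (T ` cball 0 1) = C \<inter> closure (T ` cball 0 1)" by blast
  moreover have "compact (C \<inter> closure (T ` cball 0 1))"
    using assms by (intro compact_Int_closed) auto
  ultimately show ?thesis
    using assms by (simp add: compact_ops_def)
qed

lemma compact_ops_cball:
  assumes "T \<in> compact_ops"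
  obtains C where "compact C" "T ` cball 0 r \<subseteq> C"
proof
  define s where "s = \<bar>r\<bar> + 1"
  have s: "s > 0" "r \<le> s" by (auto simp: s_def)
  show "compact ((\<lambda>\<psi>. s *\<^sub>R \<psi>) ` closure (T ` cball 0 1))"
    using assms by (intro compact_scaling) (simp add: compact_ops_def)
  show "T ` cball 0 r \<subseteq> (\<lambda>\<psi>. s *\<^sub>R \<psi>) ` closure (T ` cball 0 1)"
  proof
    fix \<psi> assume "\<psi> \<in> T ` cball 0 r"
    then obtain \<phi> where \<phi>: "\<psi> = T \<phi>" "norm \<phi> \<le> r" by auto
    have "T ((1 / s) *\<^sub>R \<phi>) \<in> closure (T ` cball 0 1)"
      using \<phi> s by (intro closure_subset[THEN subsetD] imageI) (simp add: divide_simps)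
    moreover have "\<psi> = s *\<^sub>R T ((1 / s) *\<^sub>R \<phi>)"
      using s by (simp add: \<phi> blinfun.scaleR_right)
    ultimately show "\<psi> \<in> (\<lambda>\<psi>. s *\<^sub>R \<psi>) ` closure (T ` cball 0 1)" by blast
  qed
qed

lemma operator_ideal_compact_ops: "operator_ideal compact_ops bounded_ops"
proof -
  have bdd: "X \<in> bounded_ops" if "X \<in> compact_ops" for X :: "'a op"
    using that by (simp add: compact_ops_def)
  have "(0 :: 'a op) \<in> compact_ops"
    by (rule compact_opsI[where C = "{0}"]) (auto simp: bounded_ops_zero)
  moreover have "X + Y \<in> compact_ops" if XY: "X \<in> compact_ops" "Y \<in> compact_ops" for X Y :: "'a op"
  proof -
    obtain C where C: "compact C" "X ` cball 0 1 \<subseteq> C" by (rule compact_ops_cball[OF XY(1)])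
    obtain D where D: "compact D" "Y ` cball 0 1 \<subseteq> D" by (rule compact_ops_cball[OF XY(2)])
    show ?thesis
    proof (rule compact_opsI)
      show "X + Y \<in> bounded_ops" using XY bdd by (intro bounded_ops_add) auto
      show "compact {x + y |x y. x \<in> C \<and> y \<in> D}" by (rule compact_sums[OF C(1) D(1)])
      show "(X + Y) ` cball 0 1 \<subseteq> {x + y |x y. x \<in> C \<and> y \<in> D}"
        using C(2) D(2) by (fastforce simp: blinfun.add_left)
    qed
  qed
  moreover have "T o\<^sub>L X \<in> compact_ops" if X: "X \<in> compact_ops" and T: "T \<in> bounded_ops" for X T :: "'a op"
  proof -
    obtain C where C: "compact C" "X ` cball 0 1 \<subseteq> C" by (rule compact_ops_cball[OF X])
    show ?thesis
    proof (rule compact_opsI)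
      show "T o\<^sub>L X \<in> bounded_ops" using X T bdd by (intro bounded_ops_compose) auto
      show "compact (T ` C)"
        by (rule compact_continuous_image[OF _ C(1)]) (rule linear_continuous_on[OF blinfun.bounded_linear_right])
      show "(T o\<^sub>L X) ` cball 0 1 \<subseteq> T ` C"
        using C(2) by auto
    qed
  qed
  moreover have "X o\<^sub>L T \<in> compact_ops" if X: "X \<in> compact_ops" and T: "T \<in> bounded_ops" for X T :: "'a op"
  proof -
    obtain C where C: "compact C" "X ` cball 0 (norm T) \<subseteq> C" by (rule compact_ops_cball[OF X])
    have "norm (T \<phi>) \<le> norm T" if "norm \<phi> \<le> 1" for \<phi>
      using norm_blinfun[of T \<phi>] mult_left_le[OF that norm_ge_zero[of T]] by linarith
    then have "(X o\<^sub>L T) ` cball 0 1 \<subseteq> C"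
      using C(2) by auto
    then show ?thesis
      using C(1) X T bdd by (intro compact_opsI bounded_ops_compose) auto
  qed
  ultimately show ?thesis
    using bdd by (auto simp: operator_ideal_def)
qed

section \<open>The ideal of operators near the half-space\<close>

definition half_space_supported :: "'d::finite \<Rightarrow> 'd lattice op set" where
  "half_space_supported e = {X \<in> bounded_ops.
     \<exists>n\<ge>1. half_space_proj e n o\<^sub>L X = X \<and> X o\<^sub>L half_space_proj e n = X}"

lemma half_space_supported_mono:
  assumes "half_space_proj e n o\<^sub>L X = X" "X o\<^sub>L half_space_proj e n = X" "n \<le> m"
  shows "half_space_proj e m o\<^sub>L X = X" "X o\<^sub>L half_space_proj e m = X"
  using assms by (metis compose_assoc half_space_proj_compose)+

lemma half_space_supported_pair:
  assumes "X \<in> half_space_supported e" "Y \<in> half_space_supported e"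
  obtains n where "n \<ge> 1" "half_space_proj e n o\<^sub>L X = X" "X o\<^sub>L half_space_proj e n = X"
    "half_space_proj e n o\<^sub>L Y = Y" "Y o\<^sub>L half_space_proj e n = Y"
proof -
  from assms[unfolded half_space_supported_def] obtain n m where n: "n \<ge> 1" "half_space_proj e n o\<^sub>L X = X" "X o\<^sub>L half_space_proj e n = X"
    and m: "half_space_proj e m o\<^sub>L Y = Y" "Y o\<^sub>L half_space_proj e m = Y" by auto
  show ?thesis
    using that[of "max n m"] n half_space_supported_mono[OF n(2,3), of "max n m"]
      half_space_supported_mono[OF m, of "max n m"] by simp
qed

lemma half_space_supported_add:
  assumes XY: "X \<in> half_space_supported e" "Y \<in> half_space_supported e"
  shows "X + Y \<in> half_space_supported e"
proof -
  obtain n where "n \<ge> 1" "half_space_proj e n o\<^sub>L X = X" "X o\<^sub>L half_space_proj e n = X"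
    "half_space_proj e n o\<^sub>L Y = Y" "Y o\<^sub>L half_space_proj e n = Y"
    by (rule half_space_supported_pair[OF XY])
  then show ?thesis
    using XY
    by (auto simp: half_space_supported_def compose_add_left compose_add_right bounded_ops_add
        intro!: exI[of _ n])
qed

lemma closure_closed_binary:
  fixes f :: "'a::metric_space \<Rightarrow> 'a \<Rightarrow> 'a"
  assumes xy: "x \<in> closure S" "y \<in> closure S"
    and S: "\<And>u v. u \<in> S \<Longrightarrow> v \<in> S \<Longrightarrow> f u v \<in> S"
    and f: "\<And>u v. u \<longlonglongrightarrow> x \<Longrightarrow> v \<longlonglongrightarrow> y \<Longrightarrow> (\<lambda>n. f (u n) (v n)) \<longlonglongrightarrow> f x y"
  shows "f x y \<in> closure S"
proof -
  obtain u v where u: "\<And>n. u n \<in> S" "u \<longlonglongrightarrow> x" and v: "\<And>n. v n \<in> S" "v \<longlonglongrightarrow> y"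
    using xy unfolding closure_sequential by blast
  show ?thesis
    unfolding closure_sequential
    by (intro exI[of _ "\<lambda>n. f (u n) (v n)"] conjI allI S f u v)
qed

lemma half_space_ideal_closure: "half_space_ideal e = closure (half_space_supported e)"
  by (simp add: half_space_ideal_def half_space_supported_def)

lemma half_space_ideal_add:
  "X \<in> half_space_ideal e \<Longrightarrow> Y \<in> half_space_ideal e \<Longrightarrow> X + Y \<in> half_space_ideal e"
  unfolding half_space_ideal_closure
  by (erule (1) closure_closed_binary) (auto intro: tendsto_add half_space_supported_add)

lemma half_space_supported_compose:
  assumes XY: "X \<in> half_space_supported e" "Y \<in> half_space_supported e"
  shows "X o\<^sub>L Y \<in> half_space_supported e"
proof -
  obtain n where n: "n \<ge> 1" "half_space_proj e n o\<^sub>L X = X" "X o\<^sub>L half_space_proj e n = X"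
    "half_space_proj e n o\<^sub>L Y = Y" "Y o\<^sub>L half_space_proj e n = Y"
    by (rule half_space_supported_pair[OF XY])
  have "half_space_proj e n o\<^sub>L (X o\<^sub>L Y) = X o\<^sub>L Y" "(X o\<^sub>L Y) o\<^sub>L half_space_proj e n = X o\<^sub>L Y"
    using n by (metis compose_assoc)+
  then show ?thesis
    using XY n(1) by (auto simp: half_space_supported_def bounded_ops_compose)
qed

lemma half_space_ideal_compose:
  "X \<in> half_space_ideal e \<Longrightarrow> Y \<in> half_space_ideal e \<Longrightarrow> X o\<^sub>L Y \<in> half_space_ideal e"
  unfolding half_space_ideal_closure
  by (erule (1) closure_closed_binary)
    (auto intro: half_space_supported_compose bounded_bilinear.tendsto[OF bounded_bilinear_blinfun_compose])

lemma half_space_ideal_zero: "0 \<in> half_space_ideal e"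
  using closure_subset bounded_ops_zero
  by (fastforce simp: half_space_ideal_closure half_space_supported_def)

lemma half_space_ideal_bounded_ops: "half_space_ideal e \<subseteq> bounded_ops"
  unfolding half_space_ideal_closure
  by (rule closure_minimal[OF _ closed_bounded_ops]) (auto simp: half_space_supported_def)

text \<open>If \<open>X\<close> is fixed by \<open>p\<^sub>n\<close> and \<open>f\<close> is a slow cutoff, then
  \<open>f T X\<close> is fixed by a larger projection, and \<open>T X - f T X\<close> is the small commutator of
  \<open>T\<close> and \<open>f\<close> applied to \<open>X\<close>, because \<open>f X = X\<close>.\<close>

lemma almost_commutes_idealizer:
  assumes T: "T \<in> bounded_ops" and comm: "almost_commutes_with_cutoffs e T"
  shows "T \<in> idealizer (half_space_ideal e)"
proof -
  \<comment> \<open>By continuity it suffices to multiply operators supported in a half-space.\<close>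
  have approx: "T o\<^sub>L X \<in> half_space_ideal e \<and> X o\<^sub>L T \<in> half_space_ideal e"
    if X: "X \<in> half_space_supported e" for X
  proof -
    from X obtain n where n: "n \<ge> 1" "half_space_proj e n o\<^sub>L X = X" "X o\<^sub>L half_space_proj e n = X"
      and Xb: "X \<in> bounded_ops"
      by (auto simp: half_space_supported_def)
    \<comment> \<open>The successor avoids the degenerate ramp of width \<open>0\<close>.\<close>
    define f where "f N = cutoff e n (Suc N)" for N
    define p where "p N = half_space_proj e (n + Suc N)" for N
    have fb: "f N \<in> bounded_ops" for N by (simp add: f_def cutoff_bounded_ops)
    have pf: "p N o\<^sub>L f N = f N" "f N o\<^sub>L p N = f N" for N
      unfolding p_def f_def by (rule half_space_proj_compose_cutoff)+
    have pX: "p N o\<^sub>L X = X" "X o\<^sub>L p N = X" for N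
      unfolding p_def by (rule half_space_supported_mono[OF n(2,3)]; simp)+
    have fX: "f N o\<^sub>L X = X" "X o\<^sub>L f N = X" for N
      using n cutoff_compose_half_space_proj[of "Suc N" e n] unfolding f_def
      by (metis compose_assoc le_add1 plus_1_eq_Suc)+
    have lim: "(\<lambda>N. commutator T (f N)) \<longlonglongrightarrow> 0"
      unfolding f_def using comm by (intro LIMSEQ_Suc) (simp add: almost_commutes_with_cutoffs_def)
    have "(\<lambda>N. (T o\<^sub>L X) - (commutator T (f N) o\<^sub>L X)) \<longlonglongrightarrow> (T o\<^sub>L X) - (0 o\<^sub>L X)"
      by (intro tendsto_diff tendsto_const lim bounded_bilinear.tendsto[OF bounded_bilinear_blinfun_compose])
    moreover have "(T o\<^sub>L X) - (commutator T (f N) o\<^sub>L X) = f N o\<^sub>L (T o\<^sub>L X)" for N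
      by (simp add: compose_diff_left compose_assoc fX)
    moreover have "f N o\<^sub>L (T o\<^sub>L X) \<in> half_space_supported e" for N
      using pf pX T Xb fb
      by (auto simp: half_space_supported_def bounded_ops_compose p_def intro!: exI[of _ "n + Suc N"])
        (metis compose_assoc)+
    ultimately have 1: "T o\<^sub>L X \<in> half_space_ideal e"
      unfolding half_space_ideal_closure closure_sequential
      by (intro exI[of _ "\<lambda>N. f N o\<^sub>L (T o\<^sub>L X)"]) simp
    have "(\<lambda>N. (X o\<^sub>L T) + (X o\<^sub>L commutator T (f N))) \<longlonglongrightarrow> (X o\<^sub>L T) + (X o\<^sub>L 0)"
      by (intro tendsto_add tendsto_const lim bounded_bilinear.tendsto[OF bounded_bilinear_blinfun_compose])
    moreover have "(X o\<^sub>L T) + (X o\<^sub>L commutator T (f N)) = (X o\<^sub>L T) o\<^sub>L f N" for N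
      by (simp add: compose_diff_right compose_assoc[symmetric] fX)
    moreover have "(X o\<^sub>L T) o\<^sub>L f N \<in> half_space_supported e" for N
      using pf pX T Xb fb
      by (auto simp: half_space_supported_def bounded_ops_compose p_def intro!: exI[of _ "n + Suc N"])
        (metis compose_assoc)+
    ultimately have 2: "X o\<^sub>L T \<in> half_space_ideal e"
      unfolding half_space_ideal_closure closure_sequential
      by (intro exI[of _ "\<lambda>N. (X o\<^sub>L T) o\<^sub>L f N"]) simp
    from 1 2 show ?thesis by simp
  qed
  have "(\<lambda>X. T o\<^sub>L X) ` half_space_ideal e \<subseteq> half_space_ideal e"
    "(\<lambda>X. X o\<^sub>L T) ` half_space_ideal e \<subseteq> half_space_ideal e"
    using approx unfolding half_space_ideal_closure
    by (intro image_closure_subset closed_closure image_subsetI; auto intro!: continuous_intros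
        bounded_bilinear.continuous_on[OF bounded_bilinear_blinfun_compose])+
  with T show ?thesis
    by (auto simp: idealizer_def)
qed

lemma operator_algebra_idealizer: "operator_algebra (idealizer (half_space_ideal e))"
  unfolding operator_algebra_def
proof (intro conjI ballI)
  let ?J = "half_space_ideal e"
  show "idealizer ?J \<subseteq> bounded_ops"
    by (auto simp: idealizer_def)
  show "range scalar_op \<subseteq> idealizer ?J"
    by (auto intro: almost_commutes_idealizer scalar_op_bounded_ops scalar_op_almost_commutes)
  fix S T assume ST: "S \<in> idealizer ?J" "T \<in> idealizer ?J"
  then show "S + T \<in> idealizer ?J"
    by (auto simp: idealizer_def compose_add_left compose_add_right half_space_ideal_add bounded_ops_add)
  have "(S o\<^sub>L T) o\<^sub>L X \<in> ?J" if "X \<in> ?J" for X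
    using ST that by (simp add: idealizer_def compose_assoc)
  moreover have "X o\<^sub>L (S o\<^sub>L T) \<in> ?J" if "X \<in> ?J" for X
    using ST that by (simp add: idealizer_def compose_assoc[symmetric])
  ultimately show "S o\<^sub>L T \<in> idealizer ?J"
    using ST by (auto simp: idealizer_def bounded_ops_compose)
qed

lemma operator_ideal_half_space_ideal:
  "operator_ideal (half_space_ideal e) (idealizer (half_space_ideal e))"
  using half_space_ideal_bounded_ops[of e]
  by (auto simp: operator_ideal_def half_space_ideal_zero half_space_ideal_add half_space_ideal_compose
      idealizer_def)

section \<open>Operators that vanish along translations\<close>

text \<open>For \<open>k > 0\<close> the translations by \<open>n k\<close> move functions towards negative \<open>x\<^sub>1\<close>, away from
  the half-space.\<close>

definition vanishing_ops :: "'d::finite \<Rightarrow> int \<Rightarrow> 'd lattice op set" where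
  "vanishing_ops e k = {X. \<forall>\<phi>. (\<lambda>n. blinfun_apply X (translation e (int n * k) \<phi>)) \<longlonglongrightarrow> 0}"

lemma vanishing_ops_if_on_sites:
  fixes X :: "'d::finite lattice op"
  assumes "\<And>y c. (\<lambda>n. X (ell2_site (y - axis e (int n * k)) c)) \<longlonglongrightarrow> 0"
  shows "X \<in> vanishing_ops e k"
proof -
  have "(\<lambda>n. (X o\<^sub>L translation e (int n * k)) \<phi>) \<longlonglongrightarrow> 0" for \<phi>
  proof (rule tendsto_zero_if_on_sites)
    show "norm (X o\<^sub>L translation e (int n * k)) \<le> norm X" for n
      using norm_blinfun_compose[of X "translation e (int n * k)"]
        mult_left_le[OF norm_translation_le[of e "int n * k"] norm_ge_zero[of X]] by linarith
  qed (use assms in \<open>simp add: translation_site\<close>)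
  then show ?thesis by (simp add: vanishing_ops_def)
qed

lemma vanishing_ops_add:
  fixes X Y :: "'d::finite lattice op"
  assumes "X \<in> vanishing_ops e k" "Y \<in> vanishing_ops e k"
  shows "X + Y \<in> vanishing_ops e k"
  using assms tendsto_add[of _ "0 :: 'd lattice ell2" sequentially _ 0]
  by (fastforce simp: vanishing_ops_def blinfun.add_left)

lemma vanishing_ops_compose:
  fixes X T :: "'d::finite lattice op"
  assumes "X \<in> vanishing_ops e k"
  shows "T o\<^sub>L X \<in> vanishing_ops e k"
proof -
  have "(\<lambda>n. T (X (translation e (int n * k) \<phi>))) \<longlonglongrightarrow> T 0" for \<phi>
    using assms by (intro blinfun.tendsto tendsto_const) (simp add: vanishing_ops_def)
  then show ?thesis
    by (simp add: vanishing_ops_def)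
qed

text \<open>Translations are isometries, so a norm approximation of \<open>X\<close> is uniform along the orbit of
  \<open>\<phi>\<close>.\<close>

lemma closed_vanishing_ops: "closed (vanishing_ops (e :: 'd::finite) k)"
proof (rule closed_sequential_limits[THEN iffD2], intro allI impI, elim conjE)
  fix Y X assume Y: "\<forall>i. Y i \<in> vanishing_ops e k" and lim: "Y \<longlonglongrightarrow> X"
  show "X \<in> vanishing_ops e k"
    unfolding vanishing_ops_def
  proof (intro CollectI allI LIMSEQ_I)
    fix \<phi> :: "'d lattice ell2" and \<epsilon> :: real assume \<epsilon>: "\<epsilon> > 0"
    define \<tau> where "\<tau> n = translation e (int n * k) \<phi>" for n
    have \<tau>: "norm (\<tau> n) = norm \<phi>" for n by (simp add: \<tau>_def norm_translation_apply)
    define \<delta> where "\<delta> = \<epsilon> / (2 * (norm \<phi> + 1))"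
    have \<delta>: "\<delta> > 0" using \<epsilon> by (simp add: \<delta>_def add_nonneg_pos)
    have "\<delta> * norm \<phi> \<le> \<delta> * (norm \<phi> + 1)" using \<delta> by simp
    also have "\<dots> = \<epsilon> / 2"
      using add_nonneg_pos[OF norm_ge_zero[of \<phi>] zero_less_one] by (simp add: \<delta>_def divide_simps)
    finally have \<delta>\<phi>: "\<delta> * norm \<phi> \<le> \<epsilon> / 2" .
    obtain i where i: "norm (Y i - X) < \<delta>"
      using LIMSEQ_D[OF lim \<delta>] by blast
    have "(\<lambda>n. Y i (\<tau> n)) \<longlonglongrightarrow> 0"
      using Y by (simp add: vanishing_ops_def \<tau>_def)
    then obtain M where M: "\<forall>n\<ge>M. norm (Y i (\<tau> n)) < \<epsilon> / 2"
      using LIMSEQ_D[of _ 0 "\<epsilon> / 2"] \<epsilon> by fastforce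
    have "norm (X (\<tau> n) - 0) < \<epsilon>" if n: "n \<ge> M" for n
    proof -
      have "norm ((Y i - X) (\<tau> n)) \<le> \<delta> * norm \<phi>"
        using norm_blinfun[of "Y i - X" "\<tau> n"] mult_right_mono[OF less_imp_le[OF i] norm_ge_zero[of \<phi>]]
        unfolding \<tau> by linarith
      moreover have "X (\<tau> n) = Y i (\<tau> n) - (Y i - X) (\<tau> n)"
        by (simp add: blinfun.diff_left)
      moreover have "norm (Y i (\<tau> n)) < \<epsilon> / 2"
        using M n by blast
      ultimately show ?thesis
        using norm_triangle_ineq4[of "Y i (\<tau> n)" "(Y i - X) (\<tau> n)"] \<delta>\<phi> by simp
    qed
    then show "\<exists>M. \<forall>n\<ge>M. norm (X (translation e (int n * k) \<phi>) - 0) < \<epsilon>"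
      unfolding \<tau>_def by blast
  qed
qed

text \<open>Each site is moved out of the half-space \<open>x\<^sub>1 \<ge> -m\<close> after finitely many translations.\<close>

lemma half_space_proj_vanishing:
  fixes e :: "'d::finite"
  assumes k: "k \<ge> 1"
  shows "half_space_proj e m \<in> vanishing_ops e k"
proof (rule vanishing_ops_if_on_sites)
  fix y :: "'d lattice" and c
  have "half_space_proj e m (ell2_site (y - axis e (int n * k)) c) = 0"
    if n: "n \<ge> nat (y $ e + int m + 1)" for n
  proof (rule ell2_eqI)
    fix x :: "'d lattice"
    have "int n * 1 \<le> int n * k" using k by (intro mult_left_mono) auto
    then have "\<not> - int m \<le> (y - axis e (int n * k)) $ e"
      using n by (simp add: axis_def)
    then show "ell2_apply (half_space_proj e m (ell2_site (y - axis e (int n * k)) c)) x = ell2_apply 0 x"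
      by (auto simp: half_space_proj_apply ell2_site.rep_eq ell2_apply_simps)
  qed
  then show "(\<lambda>n. half_space_proj e m (ell2_site (y - axis e (int n * k)) c)) \<longlonglongrightarrow> 0"
    by (intro tendsto_eventually eventually_sequentiallyI) blast
qed

lemma half_space_ideal_vanishing:
  assumes k: "k \<ge> 1"
  shows "half_space_ideal e \<subseteq> vanishing_ops e k"
  unfolding half_space_ideal_closure
proof (rule closure_minimal[OF _ closed_vanishing_ops], rule subsetI)
  fix X assume "X \<in> half_space_supported e"
  then obtain n where "X o\<^sub>L half_space_proj e n = X"
    by (auto simp: half_space_supported_def)
  then show "X \<in> vanishing_ops e k"
    using vanishing_ops_compose[OF half_space_proj_vanishing[OF k, of e n], of X] by simp
qed

text \<open>The assumption is what a bounded orthogonal sequence satisfies.  Along a subsequence the images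
  under a compact operator converge to some \<open>l\<close>, and so do their averages; but the averages of
  \<open>M\<close> terms of \<open>u\<close> have norm at most \<open>C / sqrt M\<close>, which forces \<open>l = 0\<close>.\<close>

lemma compact_op_tendsto_zero:
  fixes u :: "nat \<Rightarrow> 'a ell2"
  assumes X: "X \<in> compact_ops"
    and u: "\<And>F. finite F \<Longrightarrow> norm (\<Sum>n\<in>F. u n) \<le> C * sqrt (real (card F))"
  shows "(\<lambda>n. X (u n)) \<longlonglongrightarrow> 0"
proof (rule ccontr)
  assume "\<not> ?thesis"
  then obtain \<epsilon> where \<epsilon>: "\<epsilon> > 0" and "\<not> (\<forall>\<^sub>F n in sequentially. norm (X (u n)) < \<epsilon>)"
    by (auto simp: tendsto_iff)
  then obtain r :: "nat \<Rightarrow> nat" where r: "strict_mono r" and "\<forall>n. \<not> norm (X (u (r n))) < \<epsilon>"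
    using not_eventually_sequentiallyD by blast
  then have large: "norm (X (u (r n))) \<ge> \<epsilon>" for n
    by (simp add: not_less)
  obtain K where K: "compact K" "X ` cball 0 C \<subseteq> K"
    by (rule compact_ops_cball[OF X])
  have "norm (u n) \<le> C" for n
    using u[of "{n}"] by simp
  then have "\<forall>n. X (u (r n)) \<in> K"
    using K(2) by auto
  then obtain l s where s: "strict_mono s" and l: "((\<lambda>n. X (u (r n))) \<circ> s) \<longlonglongrightarrow> l"
    using K(1) unfolding compact_eq_seq_compact_metric seq_compact_def by metis
  define t where "t = r \<circ> s"
  have t: "inj t"
    unfolding t_def using r s by (intro strict_mono_imp_inj_on strict_mono_o)
  have l: "(\<lambda>j. X (u (t j))) \<longlonglongrightarrow> l"
    using l by (simp add: t_def o_def)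
  have l_large: "\<epsilon> \<le> norm l"
    by (rule LIMSEQ_le_const[OF tendsto_norm[OF l]]) (auto simp: t_def large)
  obtain j0 where j0: "\<forall>j\<ge>j0. norm (X (u (t j)) - l) < \<epsilon> / 2"
    using LIMSEQ_D[OF l, of "\<epsilon>/2"] \<epsilon> by auto
  have bound: "real M * (\<epsilon> / 2) \<le> norm X * C * sqrt (real M)" for M
  proof -
    \<comment> \<open>A block of \<open>M\<close> terms that are all within \<open>\<epsilon> / 2\<close> of \<open>l\<close>; its sum is compared with
      \<open>M l\<close>.\<close>
    let ?I = "{j0..<j0 + M}"
    have "norm (\<Sum>j\<in>?I. u (t j)) \<le> C * sqrt (real M)"
      using u[of "t ` ?I"] t by (simp add: sum.reindex card_image inj_on_subset)
    then have "norm (X (\<Sum>j\<in>?I. u (t j))) \<le> norm X * (C * sqrt (real M))"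
      using norm_blinfun[of X "\<Sum>j\<in>?I. u (t j)"] by (meson mult_left_mono norm_ge_zero order_trans)
    moreover have "norm (\<Sum>j\<in>?I. X (u (t j)) - l) \<le> (\<Sum>j\<in>?I. \<epsilon> / 2)"
      using j0 by (intro sum_norm_le) (auto intro: less_imp_le)
    moreover have "real M *\<^sub>R l = X (\<Sum>j\<in>?I. u (t j)) - (\<Sum>j\<in>?I. X (u (t j)) - l)"
      by (simp add: blinfun.sum_right sum_subtractf sum_constant_scaleR)
    moreover have "real M * \<epsilon> \<le> norm (real M *\<^sub>R l)"
      using l_large by (simp add: mult_left_mono)
    ultimately show ?thesis
      using norm_triangle_ineq4[of "X (\<Sum>j\<in>?I. u (t j))" "\<Sum>j\<in>?I. X (u (t j)) - l"] by (simp add: mult.assoc)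
  qed
  define q where "q = 2 * norm X * C / \<epsilon>"
  obtain M where M: "real M > q\<^sup>2"
    using reals_Archimedean2 by blast
  have "q < sqrt (real M)"
    using real_less_rsqrt[OF M] .
  moreover have "sqrt (real M) > 0"
    using order_le_less_trans[OF zero_le_power2 M] by simp
  ultimately have "q * sqrt (real M) < sqrt (real M) * sqrt (real M)"
    by (rule mult_strict_right_mono)
  then show False
    using bound[of M] \<epsilon> by (simp add: q_def field_simps)
qed

text \<open>The translates of one site are distinct sites, hence orthogonal.\<close>

lemma compact_ops_vanishing:
  fixes e :: "'d::finite"
  assumes k: "k \<ge> 1"
  shows "(compact_ops :: 'd lattice op set) \<subseteq> vanishing_ops e k"
proof
  fix X :: "'d lattice op" assume X: "X \<in> compact_ops"
  show "X \<in> vanishing_ops e k"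
  proof (rule vanishing_ops_if_on_sites, rule compact_op_tendsto_zero[OF X])
    fix y :: "'d lattice" and c and F :: "nat set" assume F: "finite F"
    let ?g = "\<lambda>n. y - axis e (int n * k)"
    have inj: "inj_on ?g F"
      using k by (auto intro!: inj_onI simp: axis_eq_axis)
    have "(\<Sum>n\<in>F. ell2_site (?g n) c) = (\<Sum>x\<in>?g ` F. ell2_site x c)"
      by (simp add: sum.reindex[OF inj])
    also have "norm \<dots> \<le> sqrt (\<Sum>x\<in>?g ` F. (cmod c)\<^sup>2)"
      using F by (intro norm_sum_sites_le) auto
    also have "\<dots> = cmod c * sqrt (real (card F))"
      by (simp add: card_image[OF inj] real_sqrt_mult)
    finally show "norm (\<Sum>n\<in>F. ell2_site (?g n) c) \<le> cmod c * sqrt (real (card F))" .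
  qed
qed

section \<open>Invertibility of the periodic part\<close>

lemma invertible_if_bounded_below_dense_range:
  fixes D :: "'a op"
  assumes D: "D \<in> bounded_ops" and c: "0 \<le> c" and below: "\<And>\<phi>. norm \<phi> \<le> c * norm (D \<phi>)"
    and dense: "\<And>\<phi>. \<exists>\<psi>. (\<lambda>n. D (\<psi> n)) \<longlonglongrightarrow> \<phi>"
  shows "\<exists>R\<in>bounded_ops. D o\<^sub>L R = id_blinfun \<and> R o\<^sub>L D = id_blinfun"
proof -
  have inj: "inj D"
  proof (rule injI)
    fix \<phi> \<psi> assume "D \<phi> = D \<psi>"
    then show "\<phi> = \<psi>"
      using below[of "\<phi> - \<psi>"] by (simp add: blinfun.diff_right)
  qed
  have "\<exists>\<eta>. D \<eta> = \<phi>" for \<phi>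
  proof -
    obtain \<psi> where \<psi>: "(\<lambda>n. D (\<psi> n)) \<longlonglongrightarrow> \<phi>"
      using dense by blast
    have "Cauchy \<psi>"
    proof (rule CauchyI)
      fix \<epsilon> :: real assume \<epsilon>: "\<epsilon> > 0"
      then obtain M where M: "\<forall>m\<ge>M. \<forall>n\<ge>M. norm (D (\<psi> m) - D (\<psi> n)) < \<epsilon> / (c + 1)"
        using CauchyD[OF LIMSEQ_imp_Cauchy[OF \<psi>], of "\<epsilon> / (c + 1)"] c by auto
      have "norm (\<psi> m - \<psi> n) < \<epsilon>" if "m \<ge> M" "n \<ge> M" for m n
      proof -
        have "norm (\<psi> m - \<psi> n) \<le> c * norm (D (\<psi> m) - D (\<psi> n))"
          using below[of "\<psi> m - \<psi> n"] by (simp add: blinfun.diff_right)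
        also have "\<dots> \<le> (c + 1) * norm (D (\<psi> m) - D (\<psi> n))"
          by (intro mult_right_mono) auto
        also have "\<dots> < \<epsilon>"
          using M that c by (simp add: pos_less_divide_eq mult.commute)
        finally show ?thesis .
      qed
      then show "\<exists>M. \<forall>m\<ge>M. \<forall>n\<ge>M. norm (\<psi> m - \<psi> n) < \<epsilon>" by blast
    qed
    then obtain \<eta> where "\<psi> \<longlonglongrightarrow> \<eta>"
      using ell2_complete convergent_def by blast
    then have "(\<lambda>n. D (\<psi> n)) \<longlonglongrightarrow> D \<eta>"
      by (intro blinfun.tendsto tendsto_const)
    then show ?thesis
      using LIMSEQ_unique[OF _ \<psi>] by blast
  qed
  then have surj: "surj D" by (metis surjI surj_def)
  define R where "R = inv_into UNIV D"
  have DR: "D (R \<phi>) = \<phi>" for \<phi>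
    by (simp add: R_def surj_f_inv_f[OF surj])
  have RD: "R (D \<phi>) = \<phi>" for \<phi>
    by (simp add: R_def inj)
  have "bounded_linear R"
  proof (rule bounded_linear_intro[where K = c])
    show "R (\<phi> + \<psi>) = R \<phi> + R \<psi>" for \<phi> \<psi>
      using RD[of "R \<phi> + R \<psi>"] by (simp add: blinfun.add_right DR)
    show "R (r *\<^sub>R \<phi>) = r *\<^sub>R R \<phi>" for r \<phi>
      using RD[of "r *\<^sub>R R \<phi>"] by (simp add: blinfun.scaleR_right DR)
    show "norm (R \<phi>) \<le> norm \<phi> * c" for \<phi>
      using below[of "R \<phi>"] by (simp add: DR mult.commute)
  qed
  then have R: "blinfun_apply (Blinfun R) = R"
    by (rule bounded_linear_Blinfun_apply)
  have "Blinfun R \<in> bounded_ops"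
    using bounded_opsD[OF D] RD DR by (auto simp: bounded_ops_def R) metis
  moreover have "D o\<^sub>L Blinfun R = id_blinfun" "Blinfun R o\<^sub>L D = id_blinfun"
    by (auto intro!: blinfun_eqI simp: R DR RD)
  ultimately show ?thesis by blast
qed

text \<open>Far along the translations the defects of \<open>G\<close> and the perturbation \<open>B\<close> disappear, while
  the translations are isometries that commute with \<open>D\<close>.  Hence the lower bound for \<open>D + B\<close>
  becomes one for \<open>D\<close>, and the vectors \<open>T\<^sup>-\<^sup>n G T\<^sup>n \<phi>\<close> are approximate
  solutions \<open>\<psi>\<close> of \<open>D \<psi> = \<phi>\<close>.\<close>

lemma invertible_if_quasi_invertible_far_away:
  fixes D B G K1 K2 :: "'d::finite lattice op"
  assumes D: "D \<in> bounded_ops"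
    and comm: "\<And>n :: nat. D o\<^sub>L translation e (int n * k) = translation e (int n * k) o\<^sub>L D"
    and right: "(D + B) o\<^sub>L G = id_blinfun + K1" and left: "G o\<^sub>L (D + B) = id_blinfun + K2"
    and V: "K1 \<in> vanishing_ops e k" "K2 \<in> vanishing_ops e k" "B \<in> vanishing_ops e k"
      "B o\<^sub>L G \<in> vanishing_ops e k"
  shows "\<exists>R\<in>bounded_ops. D o\<^sub>L R = id_blinfun \<and> R o\<^sub>L D = id_blinfun"
proof (rule invertible_if_bounded_below_dense_range[OF D norm_ge_zero[of G]])
  define \<tau> where "\<tau> n = translation e (int n * k)" for n :: nat
  define \<tau>' where "\<tau>' n = translation e (- (int n * k))" for n :: nat
  have \<tau>\<tau>': "\<tau> n (\<tau>' n \<phi>) = \<phi>" "\<tau>' n (\<tau> n \<phi>) = \<phi>" for n \<phi>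
    using translation_compose[THEN arg_cong, of "\<lambda>T. blinfun_apply T \<phi>" e "int n * k" "- (int n * k)"]
      translation_compose[THEN arg_cong, of "\<lambda>T. blinfun_apply T \<phi>" e "- (int n * k)" "int n * k"]
    by (simp_all add: \<tau>_def \<tau>'_def translation_0)
  have norm_\<tau>: "norm (\<tau> n \<phi>) = norm \<phi>" "norm (\<tau>' n \<phi>) = norm \<phi>" for n \<phi>
    by (simp_all add: \<tau>_def \<tau>'_def norm_translation_apply)
  have D\<tau>: "D (\<tau> n \<phi>) = \<tau> n (D \<phi>)" for n \<phi>
    using comm[THEN arg_cong, of "\<lambda>T. blinfun_apply T \<phi>" n] by (simp add: \<tau>_def)
  then have D\<tau>': "D (\<tau>' n \<phi>) = \<tau>' n (D \<phi>)" for n \<phi>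
    by (metis \<tau>\<tau>')
  have V: "(\<lambda>n. K1 (\<tau> n \<phi>)) \<longlonglongrightarrow> 0" "(\<lambda>n. K2 (\<tau> n \<phi>)) \<longlonglongrightarrow> 0" "(\<lambda>n. B (\<tau> n \<phi>)) \<longlonglongrightarrow> 0"
    "(\<lambda>n. B (G (\<tau> n \<phi>))) \<longlonglongrightarrow> 0" for \<phi>
    using V by (simp_all add: vanishing_ops_def \<tau>_def)
  have right: "D (G \<phi>) = \<phi> + K1 \<phi> - B (G \<phi>)" and left: "\<phi> = G (D \<phi>) + G (B \<phi>) - K2 \<phi>" for \<phi>
    using right[THEN arg_cong, of "\<lambda>T. blinfun_apply T \<phi>"] left[THEN arg_cong, of "\<lambda>T. blinfun_apply T \<phi>"]
    by (simp_all add: blinfun.bilinear_simps algebra_simps)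
  show "norm \<phi> \<le> norm G * norm (D \<phi>)" for \<phi>
  proof (rule LIMSEQ_le_const)
    have "(\<lambda>n. norm G * norm (D \<phi>) + (norm (G (B (\<tau> n \<phi>))) + norm (K2 (\<tau> n \<phi>))))
        \<longlonglongrightarrow> norm G * norm (D \<phi>) + (norm (G 0) + norm (0 :: 'd lattice ell2))"
      by (intro tendsto_intros V)
    then show "(\<lambda>n. norm G * norm (D \<phi>) + (norm (G (B (\<tau> n \<phi>))) + norm (K2 (\<tau> n \<phi>))))
        \<longlonglongrightarrow> norm G * norm (D \<phi>)" by simp
    have "norm \<phi> \<le> norm G * norm (D \<phi>) + (norm (G (B (\<tau> n \<phi>))) + norm (K2 (\<tau> n \<phi>)))" for n
    proof -
      have "norm \<phi> = norm (G (D (\<tau> n \<phi>)) + G (B (\<tau> n \<phi>)) - K2 (\<tau> n \<phi>))"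
        using left[of "\<tau> n \<phi>"] norm_\<tau>(1)[of n \<phi>] by simp
      moreover have "norm (G (D (\<tau> n \<phi>))) \<le> norm G * norm (D \<phi>)"
        using norm_blinfun[of G "D (\<tau> n \<phi>)"] by (simp add: D\<tau> norm_\<tau>)
      ultimately show ?thesis
        using norm_triangle_ineq4[of "G (D (\<tau> n \<phi>)) + G (B (\<tau> n \<phi>))" "K2 (\<tau> n \<phi>)"]
          norm_triangle_ineq[of "G (D (\<tau> n \<phi>))" "G (B (\<tau> n \<phi>))"] by linarith
    qed
    then show "\<exists>N. \<forall>n\<ge>N. norm \<phi> \<le> norm G * norm (D \<phi>) + (norm (G (B (\<tau> n \<phi>))) + norm (K2 (\<tau> n \<phi>)))"
      by blast
  qed
  show "\<exists>\<psi>. (\<lambda>n. D (\<psi> n)) \<longlonglongrightarrow> \<phi>" for \<phi>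
  proof (intro exI[of _ "\<lambda>n. \<tau>' n (G (\<tau> n \<phi>))"])
    have "(\<lambda>n. K1 (\<tau> n \<phi>) - B (G (\<tau> n \<phi>))) \<longlonglongrightarrow> 0"
      using tendsto_diff[OF V(1) V(4)] by simp
    then have "(\<lambda>n. \<tau>' n (K1 (\<tau> n \<phi>) - B (G (\<tau> n \<phi>)))) \<longlonglongrightarrow> 0"
      by (rule Lim_null_comparison[rotated, OF tendsto_norm_zero]) (simp add: norm_\<tau>)
    then have "(\<lambda>n. \<phi> + \<tau>' n (K1 (\<tau> n \<phi>) - B (G (\<tau> n \<phi>)))) \<longlonglongrightarrow> \<phi> + 0"
      by (intro tendsto_add tendsto_const)
    moreover have "D (\<tau>' n (G (\<tau> n \<phi>))) = \<phi> + \<tau>' n (K1 (\<tau> n \<phi>) - B (G (\<tau> n \<phi>)))" for n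
      by (simp add: D\<tau>' right \<tau>\<tau>' blinfun.add_right blinfun.diff_right)
    ultimately show "(\<lambda>n. D (\<tau>' n (G (\<tau> n \<phi>)))) \<longlonglongrightarrow> \<phi>"
      by simp
  qed
qed

text \<open>Modulo \<open>\<J>\<close> the operator \<open>B G\<close> is negligible because \<open>\<J>\<close> is an ideal; modulo the
  compact operators it need not be.  But \<open>B = B f\<close> for each cutoff \<open>f\<close>, so \<open>B G\<close> is
  \<open>B G f\<close>, which vanishes far away, plus \<open>B\<close> times the commutator of \<open>f\<close> and
  \<open>G\<close>, which is small up to compact operators.\<close>

lemma compose_quasi_inverse_vanishing:
  fixes D B G K1 K2 :: "'d::finite lattice op"
  assumes k: "k \<ge> 1" and comm: "almost_commutes_with_cutoffs e D"
    and B: "half_space_proj e 0 o\<^sub>L B = B" "B o\<^sub>L half_space_proj e 0 = B"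
    and right: "(D + B) o\<^sub>L G = id_blinfun + K1" and left: "G o\<^sub>L (D + B) = id_blinfun + K2"
    and K: "K1 \<in> compact_ops" "K2 \<in> compact_ops" and G: "G \<in> bounded_ops"
  shows "B o\<^sub>L G \<in> vanishing_ops e k"
proof -
  define f where "f N = cutoff e 0 (Suc N)" for N
  define C where "C N = G o\<^sub>L commutator D (f N) o\<^sub>L G" for N
  have Bf: "B o\<^sub>L f N = B" and fB: "f N o\<^sub>L B = B" for N
    using B cutoff_compose_half_space_proj[of "Suc N" e 0] unfolding f_def
    by (metis compose_assoc le_add1 plus_1_eq_Suc)+
  have f_vanishing: "f N \<in> vanishing_ops e k" for N
    using vanishing_ops_compose[OF half_space_proj_vanishing[OF k, of e "0 + Suc N"], of "f N"]
    unfolding f_def half_space_proj_compose_cutoff .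
  have f_bounded: "f N \<in> bounded_ops" for N
    by (simp add: f_def cutoff_bounded_ops)
  have "(B o\<^sub>L G) - (B o\<^sub>L C N) \<in> vanishing_ops e k" for N
  proof -
    have "commutator (D + B) (f N) = commutator D (f N)"
      by (simp add: compose_add_left compose_add_right Bf fB)
    with commutator_quasi_inverse[OF right left, of "f N"]
    have c: "commutator (f N) G = C N + ((G o\<^sub>L f N o\<^sub>L K1) - (K2 o\<^sub>L f N o\<^sub>L G))"
      by (simp add: C_def)
    have "B o\<^sub>L G = B o\<^sub>L (f N o\<^sub>L G)"
      by (simp add: compose_assoc[symmetric] Bf)
    also have "f N o\<^sub>L G = (G o\<^sub>L f N) + commutator (f N) G"
      by simp
    \<comment> \<open>The difference is written with sums and left multiples only, under which the vanishing
      operators are closed.\<close>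
    finally have "(B o\<^sub>L G) - (B o\<^sub>L C N)
        = B o\<^sub>L ((G o\<^sub>L f N) + ((G o\<^sub>L f N o\<^sub>L K1) + (scalar_op (-1) o\<^sub>L (K2 o\<^sub>L f N o\<^sub>L G))))"
      unfolding c scalar_op_simps(3) by (simp add: compose_add_right compose_diff_right)
    also have "\<dots> \<in> vanishing_ops e k"
    proof -
      have "G o\<^sub>L f N o\<^sub>L K1 \<in> compact_ops" "K2 o\<^sub>L f N o\<^sub>L G \<in> compact_ops"
        using K G f_bounded operator_ideal_compact_ops
        by (auto simp: operator_ideal_def bounded_ops_compose)
      then have "G o\<^sub>L f N o\<^sub>L K1 \<in> vanishing_ops e k" "K2 o\<^sub>L f N o\<^sub>L G \<in> vanishing_ops e k"
        using compact_ops_vanishing[OF k] by auto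
      then show ?thesis
        by (intro vanishing_ops_compose[of _ _ _ B] vanishing_ops_compose[OF f_vanishing]
            vanishing_ops_add vanishing_ops_compose[of "K2 o\<^sub>L f N o\<^sub>L G"])
    qed
    finally show ?thesis .
  qed
  moreover have "(\<lambda>N. (B o\<^sub>L G) - (B o\<^sub>L C N)) \<longlonglongrightarrow> (B o\<^sub>L G) - (B o\<^sub>L (G o\<^sub>L 0 o\<^sub>L G))"
    unfolding C_def
  proof (intro tendsto_diff tendsto_const bounded_bilinear.tendsto[OF bounded_bilinear_blinfun_compose])
    show "(\<lambda>N. commutator D (f N)) \<longlonglongrightarrow> 0"
      using comm unfolding f_def almost_commutes_with_cutoffs_def by (intro LIMSEQ_Suc) blast
  qed
  ultimately have "(B o\<^sub>L G) - (B o\<^sub>L (G o\<^sub>L 0 o\<^sub>L G)) \<in> vanishing_ops e k"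
    by (rule closed_sequentially[OF closed_vanishing_ops])
  then show ?thesis by simp
qed

lemma translation_bounded_ops: "translation e k \<in> bounded_ops"
  by (auto simp: bounded_ops_def translation_apply ell2_apply_simps intro!: ell2_eqI)

lemma commutes_with_translation_multiples:
  assumes "A o\<^sub>L translation e k = translation e k o\<^sub>L A"
  shows "A o\<^sub>L translation e (int n * k) = translation e (int n * k) o\<^sub>L A"
proof (induction n)
  case 0
  then show ?case
    by (auto intro!: blinfun_eqI simp: translation_0)
next
  case (Suc n)
  have "translation e (int (Suc n) * k) = translation e (int n * k) o\<^sub>L translation e k"
    by (simp add: translation_compose algebra_simps)
  then show ?case
    using Suc assms by (metis compose_assoc)
qed

section \<open>Comparison of the spectra\<close>

lemma ess_spectrum_subset_op_spectrum:
  assumes T: "T \<in> bounded_ops"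
  shows "ess_spectrum T \<subseteq> op_spectrum T"
  using not_in_op_spectrum_iff[OF T]
    not_in_quotient_spectrum_iff[OF operator_algebra_bounded_ops operator_ideal_compact_ops T]
    operator_ideal_compact_ops
  by (fastforce simp: ess_spectrum_def operator_ideal_def)

theorem theorem10:
  fixes e :: "'d::finite"
    and m :: nat
    and a :: "nat \<Rightarrow> 'd lattice \<Rightarrow> complex"
    and b :: "nat \<Rightarrow> 'd lattice"
    and A B H :: "'d lattice op"
  assumes "1 \<le> m"
    and "\<And>r. r \<in> {1..m} \<Longrightarrow> bounded (range (a r))"
    and "A \<in> bounded_ops"
    and "\<And>\<phi> x. ell2_apply (A \<phi>) x = (\<Sum>r=1..m. a r x * ell2_apply \<phi> (x + b r))"
    and "periodic e A"
    and "B \<in> bounded_ops"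
    and "half_space_proj e 0 o\<^sub>L B = B"
    and "B o\<^sub>L half_space_proj e 0 = B"
    and "H = A + B"
  shows "op_spectrum A = ess_spectrum A \<and>
         ess_spectrum A = quotient_spectrum (op_algebra (idealizer (half_space_ideal e))) (half_space_ideal e) H \<and>
         quotient_spectrum (op_algebra (idealizer (half_space_ideal e))) (half_space_ideal e) H \<subseteq> ess_spectrum H \<and>
         ess_spectrum H \<subseteq> op_spectrum H"
proof -
  let ?J = "half_space_ideal e"
  let ?\<sigma>\<^sub>J = "quotient_spectrum (op_algebra (idealizer ?J)) ?J H"
  note A = assms(3) and B = assms(6)
  obtain k where k: "k \<ge> 1" and "A o\<^sub>L translation e k = translation e k o\<^sub>L A"
    using assms(5) by (auto simp: periodic_def)
  note A_periodic = commutes_with_translation_multiples[OF this(2)]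
  define D where "D z = A - scalar_op z" for z
  have D_bounded: "D z \<in> bounded_ops" for z
    by (simp add: D_def bounded_ops_diff A scalar_op_bounded_ops)
  have A_comm: "almost_commutes_with_cutoffs e A"
    by (rule finite_range_almost_commutes[OF assms(2,4)])
  then have D_comm: "almost_commutes_with_cutoffs e (D z)" for z
    unfolding D_def by (rule almost_commutes_diff[OF _ scalar_op_almost_commutes])
  have D_periodic: "D z o\<^sub>L translation e (int n * k) = translation e (int n * k) o\<^sub>L D z" for z n
    by (simp add: D_def compose_diff_left compose_diff_right A_periodic
        scalar_op_commute[OF translation_bounded_ops])
  have H: "H \<in> bounded_ops" "H - scalar_op z = D z + B" for z
    using A B assms(9) by (simp_all add: bounded_ops_add D_def)
  have "half_space_proj e 1 o\<^sub>L B = B" "B o\<^sub>L half_space_proj e 1 = B"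
    by (rule half_space_supported_mono[OF assms(7,8)]; simp)+
  then have B_ideal: "B \<in> ?J"
    using closure_subset B by (fastforce simp: half_space_ideal_closure half_space_supported_def)
  note J = operator_ideal_half_space_ideal[of e]
  have H_idealizer: "H \<in> idealizer ?J"
    using J B_ideal operator_algebraD(4)[OF operator_algebra_idealizer almost_commutes_idealizer[OF A A_comm]]
    by (auto simp: assms(9) operator_ideal_def)
  note op_iff = not_in_op_spectrum_iff[OF A, folded D_def]
  note quot_iff = not_in_quotient_spectrum_iff[OF operator_algebra_idealizer J H_idealizer, unfolded H(2)]

  \<comment> \<open>A resolvent of \<open>A\<close> is also one of \<open>H\<close> modulo \<open>\<J>\<close>.\<close>
  have "?\<sigma>\<^sub>J \<subseteq> op_spectrum A"
  proof (rule subsetI, rule ccontr)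
    fix z assume z: "z \<in> ?\<sigma>\<^sub>J" "z \<notin> op_spectrum A"
    obtain G where G: "G \<in> bounded_ops" "D z o\<^sub>L G = id_blinfun" "G o\<^sub>L D z = id_blinfun"
      using z(2) op_iff by blast
    have "G \<in> idealizer ?J"
      using G(1) inverse_almost_commutes[OF D_comm G(2,3)] by (rule almost_commutes_idealizer)
    moreover have "B o\<^sub>L G \<in> ?J" "G o\<^sub>L B \<in> ?J"
      using J B_ideal \<open>G \<in> idealizer ?J\<close> by (auto simp: operator_ideal_def)
    ultimately have "z \<notin> ?\<sigma>\<^sub>J"
      unfolding quot_iff using G by (auto simp: compose_add_left compose_add_right intro!: bexI[of _ G])
    with z(1) show False by blast
  qed
  \<comment> \<open>Translating an inverse of \<open>H - z\<close> modulo \<open>\<J>\<close> to infinity inverts \<open>A - z\<close>.\<close>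
  moreover have "op_spectrum A \<subseteq> ?\<sigma>\<^sub>J"
  proof (rule subsetI, rule ccontr)
    fix z assume z: "z \<in> op_spectrum A" "z \<notin> ?\<sigma>\<^sub>J"
    obtain G where G: "G \<in> idealizer ?J" and "((D z + B) o\<^sub>L G) - id_blinfun \<in> ?J"
      "(G o\<^sub>L (D z + B)) - id_blinfun \<in> ?J"
      using z(2) quot_iff by blast
    moreover have "B o\<^sub>L G \<in> ?J"
      using J B_ideal G by (auto simp: operator_ideal_def)
    ultimately have "\<exists>R\<in>bounded_ops. D z o\<^sub>L R = id_blinfun \<and> R o\<^sub>L D z = id_blinfun"
      using half_space_ideal_vanishing[OF k, of e] B_ideal
      by (intro invertible_if_quasi_invertible_far_away[where B = B and G = G and k = k and e = e
            and ?K1.0 = "((D z + B) o\<^sub>L G) - id_blinfun" and ?K2.0 = "(G o\<^sub>L (D z + B)) - id_blinfun"]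
          D_bounded D_periodic) auto
    with z(1) op_iff show False by blast
  qed
  \<comment> \<open>The same modulo compact operators.  The perturbation is kept general so that it can be both
    \<open>0\<close> and \<open>B\<close>.\<close>
  moreover have ess: "op_spectrum A \<subseteq> ess_spectrum (A + B')"
    if B': "B' \<in> bounded_ops" "half_space_proj e 0 o\<^sub>L B' = B'" "B' o\<^sub>L half_space_proj e 0 = B'" for B'
  proof (rule subsetI, rule ccontr)
    fix z assume z: "z \<in> op_spectrum A" "z \<notin> ess_spectrum (A + B')"
    have eq: "A + B' - scalar_op z = D z + B'"
      by (simp add: D_def)
    obtain G where G: "G \<in> bounded_ops" and K: "((D z + B') o\<^sub>L G) - id_blinfun \<in> compact_ops" (is "?K1 \<in> _")
      "(G o\<^sub>L (D z + B')) - id_blinfun \<in> compact_ops" (is "?K2 \<in> _")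
      using z(2) not_in_quotient_spectrum_iff[OF operator_algebra_bounded_ops operator_ideal_compact_ops
          bounded_ops_add[OF A B'(1)], of z, unfolded eq]
      by (auto simp: ess_spectrum_def)
    have "B' o\<^sub>L half_space_proj e 0 \<in> vanishing_ops e k"
      by (rule vanishing_ops_compose[OF half_space_proj_vanishing[OF k]])
    then have B'_vanishing: "B' \<in> vanishing_ops e k"
      by (simp add: B')
    have "B' o\<^sub>L G \<in> vanishing_ops e k"
      by (rule compose_quasi_inverse_vanishing[OF k D_comm B'(2,3) _ _ K G]) simp_all
    then have "\<exists>R\<in>bounded_ops. D z o\<^sub>L R = id_blinfun \<and> R o\<^sub>L D z = id_blinfun"
      using compact_ops_vanishing[OF k, of e] K B'_vanishing
      by (intro invertible_if_quasi_invertible_far_away[where B = B' and G = G and k = k and e = e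
            and ?K1.0 = ?K1 and ?K2.0 = ?K2] D_bounded D_periodic) auto
    with z(1) op_iff show False by blast
  qed
  moreover have "op_spectrum A \<subseteq> ess_spectrum A"
    using ess[of 0] by (simp add: bounded_ops_zero)
  moreover have "op_spectrum A \<subseteq> ess_spectrum H"
    using ess[OF B assms(7,8)] by (simp add: assms(9))
  ultimately show ?thesis
    using ess_spectrum_subset_op_spectrum[OF A] ess_spectrum_subset_op_spectrum[OF H(1)] by auto
qed

end
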